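(* Let $n\ge 2$. The pure virtual twin group $PVT_n$ has the $R_\infty$-property if and only if $n \ge 3$.
   Context: For $n\ge 2$, the virtual twin group $VT_n$ is the group with generators $s_1,\dots,s_{n-1},\rho_1,\dots,\rho_{n-1}$ and defining relations: $s_i^2=1$ and $\rho_i^2=1$ for $1\le i\le n-1$; $s_is_j=s_js_i$, $\rho_i\rho_j=\rho_j\rho_i$ and $\rho_is_j=s_j\rho_i$ for $|i-j|\ge 2$; $\rho_i\rho_{i+1}\rho_i=\rho_{i+1}\rho_i\rho_{i+1}$ and $\rho_i\rho_{i+1}s_i=s_{i+1}\rho_i\rho_{i+1}$ for $1\le i\le n-2$. The pure virtual twin group $PVT_n$ is the kernel of the surjection $\pi:VT_n\to S_n$, $\pi(s_i)=\pi(\rho_i)=(i,i+1)$. For a group $G$ and $\phi\in\operatorname{Aut}(G)$, two elements $x,y\in G$ lie in the same $\phi$-twisted conjugacy class if there is $g\in G$ with $x=gy\phi(g)^{-1}$. $G$ has the $R_\infty$-property if it has infinitely many $\phi$-twisted conjugacy classes for every $\phi\in\operatorname{Aut}(G)$. *)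

theory Defs
  imports "HOL-Algebra.Sym_Groups" "HOL-Algebra.Bij"
begin

section \<open>Groups given by generators and relations\<close>

text \<open>
  A letter \<open>(a, True)\<close> stands for the generator \<open>a\<close>, a letter \<open>(a, False)\<close> for its formal inverse.
  A pair \<open>(r, s)\<close> in a set of relations stands for the defining relation \<open>r = s\<close>.
\<close>

type_synonym 'a word = "('a \<times> bool) list"

inductive_set pres_rel :: "'a set \<Rightarrow> ('a word \<times> 'a word) set \<Rightarrow> ('a word \<times> 'a word) set"
  for X :: "'a set" and R :: "('a word \<times> 'a word) set" where
  refl: "w \<in> lists (X \<times> UNIV) \<Longrightarrow> (w, w) \<in> pres_rel X R"
| sym: "(v, w) \<in> pres_rel X R \<Longrightarrow> (w, v) \<in> pres_rel X R"
| trans: "(u, v) \<in> pres_rel X R \<Longrightarrow> (v, w) \<in> pres_rel X R \<Longrightarrow> (u, w) \<in> pres_rel X R"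
| cancel: "a \<in> X \<Longrightarrow> u \<in> lists (X \<times> UNIV) \<Longrightarrow> v \<in> lists (X \<times> UNIV)
    \<Longrightarrow> (u @ [(a, b), (a, \<not> b)] @ v, u @ v) \<in> pres_rel X R"
| relation: "(r, s) \<in> R \<Longrightarrow> r \<in> lists (X \<times> UNIV) \<Longrightarrow> s \<in> lists (X \<times> UNIV)
    \<Longrightarrow> u \<in> lists (X \<times> UNIV) \<Longrightarrow> v \<in> lists (X \<times> UNIV)
    \<Longrightarrow> (u @ r @ v, u @ s @ v) \<in> pres_rel X R"

definition presented_group :: "'a set \<Rightarrow> ('a word \<times> 'a word) set \<Rightarrow> 'a word set monoid" where
  "presented_group X R =
    \<lparr>carrier = lists (X \<times> UNIV) // pres_rel X R,
     monoid.mult = (\<lambda>A B. \<Union>u\<in>A. \<Union>v\<in>B. pres_rel X R `` {u @ v}),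
     one = pres_rel X R `` {[]}\<rparr>"

fun eval_word :: "('b, 'c) monoid_scheme \<Rightarrow> ('a \<Rightarrow> 'b) \<Rightarrow> 'a word \<Rightarrow> 'b" where
  "eval_word H f [] = \<one>\<^bsub>H\<^esub>"
| "eval_word H f ((a, b) # w) = (if b then f a else inv\<^bsub>H\<^esub> (f a)) \<otimes>\<^bsub>H\<^esub> eval_word H f w"

text \<open>
  The map on the presented group induced by a map \<open>f\<close> from the generators to \<open>H\<close>; it is meaningful
  when \<open>f\<close> respects the relations, so that all words in a class have the same value (see
  \<open>pres_lift_hom\<close> and \<open>pres_lift_generator\<close> below).
\<close>

definition pres_lift :: "('b, 'c) monoid_scheme \<Rightarrow> ('a \<Rightarrow> 'b) \<Rightarrow> 'a word set \<Rightarrow> 'b" where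
  "pres_lift H f A = the_elem (eval_word H f ` A)"

lemma pres_rel_words:
  "(v, w) \<in> pres_rel X R \<Longrightarrow> v \<in> lists (X \<times> UNIV) \<and> w \<in> lists (X \<times> UNIV)"
  by (induction rule: pres_rel.induct) auto

lemma equiv_pres_rel: "equiv (lists (X \<times> UNIV)) (pres_rel X R)"
proof (rule equivI)
  show "pres_rel X R \<subseteq> lists (X \<times> UNIV) \<times> lists (X \<times> UNIV)"
    by (auto dest: pres_rel_words simp del: in_lists_conv_set)
  show "refl_on (lists (X \<times> UNIV)) (pres_rel X R)"
    by (rule refl_onI) (rule pres_rel.refl)
  show "sym (pres_rel X R)"
    by (rule symI) (rule pres_rel.sym)
  show "trans (pres_rel X R)"
    by (rule transI) (rule pres_rel.trans)
qed

lemma pres_rel_context: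
  assumes "(v, w) \<in> pres_rel X R" "p \<in> lists (X \<times> UNIV)" "q \<in> lists (X \<times> UNIV)"
  shows "(p @ v @ q, p @ w @ q) \<in> pres_rel X R"
  using assms
proof (induction rule: pres_rel.induct)
  case (refl w)
  then show ?case by (intro pres_rel.refl) auto
next
  case (sym v w)
  then show ?case by (blast intro: pres_rel.sym)
next
  case (trans u v w)
  then show ?case by (blast intro: pres_rel.trans)
next
  case (cancel a u v b)
  then show ?case using pres_rel.cancel[of a X "p @ u" "v @ q" b R] by simp
next
  case (relation r s u v)
  then show ?case using pres_rel.relation[of r s R X "p @ u" "v @ q"] by simp
qed

lemma pres_rel_append:
  assumes "(u, u') \<in> pres_rel X R" "(v, v') \<in> pres_rel X R"
  shows "(u @ v, u' @ v') \<in> pres_rel X R"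
proof -
  have "(u @ v, u' @ v) \<in> pres_rel X R"
    using pres_rel_context[OF assms(1), of "[]" v] pres_rel_words[OF assms(2)] by simp
  moreover have "(u' @ v, u' @ v') \<in> pres_rel X R"
    using pres_rel_context[OF assms(2), of u' "[]"] pres_rel_words[OF assms(1)] by simp
  ultimately show ?thesis by (rule pres_rel.trans)
qed

lemma presented_group_mult:
  assumes "u \<in> lists (X \<times> UNIV)" "v \<in> lists (X \<times> UNIV)"
  shows "pres_rel X R `` {u} \<otimes>\<^bsub>presented_group X R\<^esub> pres_rel X R `` {v} = pres_rel X R `` {u @ v}"
proof -
  have "pres_rel X R `` {u' @ v'} = pres_rel X R `` {u @ v}"
    if "u' \<in> pres_rel X R `` {u}" "v' \<in> pres_rel X R `` {v}" for u' v'
  proof -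
    have "(u @ v, u' @ v') \<in> pres_rel X R"
      using that by (simp add: pres_rel_append)
    then show ?thesis
      using equiv_class_eq[OF equiv_pres_rel] by metis
  qed
  then have "(\<Union>u'\<in>pres_rel X R `` {u}. \<Union>v'\<in>pres_rel X R `` {v}. pres_rel X R `` {u' @ v'})
    = (\<Union>u'\<in>pres_rel X R `` {u}. \<Union>v'\<in>pres_rel X R `` {v}. pres_rel X R `` {u @ v})"
    by (intro SUP_cong HOL.refl)
  moreover have "pres_rel X R `` {u} \<noteq> {}" "pres_rel X R `` {v} \<noteq> {}"
    using pres_rel.refl[OF assms(1), of R] pres_rel.refl[OF assms(2), of R] by blast+
  ultimately show ?thesis
    by (simp add: presented_group_def)
qed

lemma presented_group_carrierE:
  assumes "A \<in> carrier (presented_group X R)"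
  obtains w where "w \<in> lists (X \<times> UNIV)" "A = pres_rel X R `` {w}"
proof -
  have "A \<in> lists (X \<times> UNIV) // pres_rel X R"
    using assms by (simp add: presented_group_def)
  then show thesis
    by (rule quotientE) (rule that)
qed

lemma presented_group_carrierI:
  "w \<in> lists (X \<times> UNIV) \<Longrightarrow> pres_rel X R `` {w} \<in> carrier (presented_group X R)"
  unfolding presented_group_def by (simp add: quotientI)

lemma pres_rel_inverse_word:
  assumes "w \<in> lists (X \<times> UNIV)"
  shows "(rev (map (\<lambda>(a, b). (a, \<not> b)) w) @ w, []) \<in> pres_rel X R"
  using assms
proof (induction w)
  case Nil
  then show ?case by (auto intro: pres_rel.refl)
next
  case (Cons l w)
  obtain a b where l: "l = (a, b)" by fastforce
  let ?i = "rev (map (\<lambda>(a, b). (a, \<not> b)) w)"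
  have "(?i @ [(a, \<not> b), (a, \<not> \<not> b)] @ w, ?i @ w) \<in> pres_rel X R"
  proof (rule pres_rel.cancel)
    show "a \<in> X" "w \<in> lists (X \<times> UNIV)" "?i \<in> lists (X \<times> UNIV)"
      using Cons.hyps Cons.prems by (auto simp: l)
  qed
  moreover have "(?i @ w, []) \<in> pres_rel X R"
    using Cons by auto
  ultimately have "(?i @ [(a, \<not> b), (a, \<not> \<not> b)] @ w, []) \<in> pres_rel X R"
    by (rule pres_rel.trans)
  then show ?case by (simp add: l)
qed

lemma presented_group_is_group: "group (presented_group X R)"
proof (rule groupI)
  have one: "\<one>\<^bsub>presented_group X R\<^esub> = pres_rel X R `` {[]}"
    by (simp add: presented_group_def)
  show "\<one>\<^bsub>presented_group X R\<^esub> \<in> carrier (presented_group X R)"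
    unfolding one by (rule presented_group_carrierI) simp
  fix A assume A: "A \<in> carrier (presented_group X R)"
  then obtain u where u: "u \<in> lists (X \<times> UNIV)" "A = pres_rel X R `` {u}"
    by (rule presented_group_carrierE)
  show "\<one>\<^bsub>presented_group X R\<^esub> \<otimes>\<^bsub>presented_group X R\<^esub> A = A"
    using u presented_group_mult[of "[]" X u R] by (simp add: one)
  let ?i = "rev (map (\<lambda>(a, b). (a, \<not> b)) u)"
  have i: "?i \<in> lists (X \<times> UNIV)" using u by auto
  have "pres_rel X R `` {?i} \<otimes>\<^bsub>presented_group X R\<^esub> A = \<one>\<^bsub>presented_group X R\<^esub>"
    using presented_group_mult[OF i u(1), of R]
      equiv_class_eq[OF equiv_pres_rel pres_rel_inverse_word[OF u(1)]]
    by (simp only: one u)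
  then show "\<exists>B\<in>carrier (presented_group X R). B \<otimes>\<^bsub>presented_group X R\<^esub> A = \<one>\<^bsub>presented_group X R\<^esub>"
    using presented_group_carrierI[OF i] by blast
  fix B assume B: "B \<in> carrier (presented_group X R)"
  then obtain v where v: "v \<in> lists (X \<times> UNIV)" "B = pres_rel X R `` {v}"
    by (rule presented_group_carrierE)
  show "A \<otimes>\<^bsub>presented_group X R\<^esub> B \<in> carrier (presented_group X R)"
    using u v by (simp add: presented_group_mult presented_group_carrierI del: in_lists_conv_set)
  fix C assume C: "C \<in> carrier (presented_group X R)"
  then obtain w where w: "w \<in> lists (X \<times> UNIV)" "C = pres_rel X R `` {w}"
    by (rule presented_group_carrierE)
  show "A \<otimes>\<^bsub>presented_group X R\<^esub> B \<otimes>\<^bsub>presented_group X R\<^esub> C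
      = A \<otimes>\<^bsub>presented_group X R\<^esub> (B \<otimes>\<^bsub>presented_group X R\<^esub> C)"
    using u v w by (simp add: presented_group_mult append_in_lists_conv del: in_lists_conv_set)
qed

lemma eval_word_closed:
  assumes "group H" "f ` X \<subseteq> carrier H" "w \<in> lists (X \<times> UNIV)"
  shows "eval_word H f w \<in> carrier H"
  using assms(3)
proof (induction w)
  case Nil
  then show ?case using assms(1) by (simp add: group.is_monoid)
next
  case (Cons l w)
  interpret H: group H by fact
  show ?case using Cons assms(2) by (cases l) auto
qed

lemma eval_word_append:
  assumes "group H" "f ` X \<subseteq> carrier H" "v \<in> lists (X \<times> UNIV)" "w \<in> lists (X \<times> UNIV)"
  shows "eval_word H f (v @ w) = eval_word H f v \<otimes>\<^bsub>H\<^esub> eval_word H f w"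
  using assms(3)
proof (induction v)
  case Nil
  interpret H: group H by fact
  show ?case using eval_word_closed[OF assms(1,2,4)] by simp
next
  case (Cons l v)
  interpret H: group H by fact
  obtain a b where l: "l = (a, b)" by fastforce
  have "v \<in> lists (X \<times> UNIV)" "f a \<in> carrier H" using Cons assms(2) l by auto
  then show ?case
    using Cons eval_word_closed[OF assms(1,2), of v] eval_word_closed[OF assms(1,2,4)]
    by (simp add: l H.m_assoc)
qed

lemma eval_word_pres_rel:
  assumes "group H" "f ` X \<subseteq> carrier H"
    and "\<And>r s. (r, s) \<in> R \<Longrightarrow> eval_word H f r = eval_word H f s"
    and "(v, w) \<in> pres_rel X R"
  shows "eval_word H f v = eval_word H f w"
  using assms(4)
proof (induction rule: pres_rel.induct)
  case (cancel a u v b)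
  interpret H: group H by fact
  have "f a \<in> carrier H" "eval_word H f v \<in> carrier H"
    using cancel assms(2) eval_word_closed[OF assms(1,2)] by auto
  then have "eval_word H f ([(a, b), (a, \<not> b)] @ v) = eval_word H f v"
    by (simp add: H.m_assoc[symmetric])
  moreover have "[(a, b), (a, \<not> b)] @ v \<in> lists (X \<times> UNIV)"
    using cancel by auto
  ultimately show ?case
    using eval_word_append[OF assms(1,2) cancel(2), of "[(a, b), (a, \<not> b)] @ v"]
      eval_word_append[OF assms(1,2) cancel(2,3)] by (simp only:)
next
  case (relation r s u v)
  then have "r @ v \<in> lists (X \<times> UNIV)" "s @ v \<in> lists (X \<times> UNIV)" by auto
  then show ?case
    by (simp only: eval_word_append[OF assms(1,2)] relation(2-5) assms(3)[OF relation(1)])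
qed auto

lemma pres_lift_class:
  assumes "group H" "f ` X \<subseteq> carrier H"
    and "\<And>r s. (r, s) \<in> R \<Longrightarrow> eval_word H f r = eval_word H f s"
    and "w \<in> lists (X \<times> UNIV)"
  shows "pres_lift H f (pres_rel X R `` {w}) = eval_word H f w"
proof -
  have "eval_word H f ` (pres_rel X R `` {w}) = {eval_word H f w}"
  proof (intro equalityI subsetI)
    fix x assume "x \<in> eval_word H f ` (pres_rel X R `` {w})"
    then obtain v where v: "(w, v) \<in> pres_rel X R" "x = eval_word H f v" by blast
    have "eval_word H f w = eval_word H f v"
      using assms(1-3) v(1) by (rule eval_word_pres_rel)
    then show "x \<in> {eval_word H f w}"
      by (simp add: v(2))
  next
    fix x assume "x \<in> {eval_word H f w}"
    then show "x \<in> eval_word H f ` (pres_rel X R `` {w})"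
      using pres_rel.refl[OF assms(4), of R] by blast
  qed
  then show ?thesis by (simp add: pres_lift_def)
qed

lemma pres_lift_hom:
  assumes "group H" "f ` X \<subseteq> carrier H"
    and "\<And>r s. (r, s) \<in> R \<Longrightarrow> eval_word H f r = eval_word H f s"
  shows "pres_lift H f \<in> hom (presented_group X R) H"
proof (rule homI)
  fix A assume A: "A \<in> carrier (presented_group X R)"
  then obtain u where u: "u \<in> lists (X \<times> UNIV)" "A = pres_rel X R `` {u}"
    by (rule presented_group_carrierE)
  have lift: "pres_lift H f (pres_rel X R `` {w}) = eval_word H f w" if "w \<in> lists (X \<times> UNIV)" for w
    using pres_lift_class[of H f X R w] assms that by blast
  show "pres_lift H f A \<in> carrier H"
    unfolding u(2) lift[OF u(1)] using assms(1,2) u(1) by (rule eval_word_closed)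
  fix B assume B: "B \<in> carrier (presented_group X R)"
  then obtain v where v: "v \<in> lists (X \<times> UNIV)" "B = pres_rel X R `` {v}"
    by (rule presented_group_carrierE)
  have uv: "u @ v \<in> lists (X \<times> UNIV)" using u v by simp
  show "pres_lift H f (A \<otimes>\<^bsub>presented_group X R\<^esub> B) = pres_lift H f A \<otimes>\<^bsub>H\<^esub> pres_lift H f B"
    unfolding u(2) v(2) presented_group_mult[OF u(1) v(1)] lift[OF u(1)] lift[OF v(1)] lift[OF uv]
    using assms(1,2) u(1) v(1) by (rule eval_word_append)
qed

lemma pres_lift_generator:
  assumes "group H" "f ` X \<subseteq> carrier H"
    and "\<And>r s. (r, s) \<in> R \<Longrightarrow> eval_word H f r = eval_word H f s"
    and "a \<in> X"
  shows "pres_lift H f (pres_rel X R `` {[(a, True)]}) = f a"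
proof -
  interpret H: group H by fact
  have "f a \<in> carrier H" "[(a, True)] \<in> lists (X \<times> UNIV)" using assms(2,4) by auto
  then show ?thesis using pres_lift_class[of H f X R "[(a, True)]"] assms(1-3) by simp
qed


section \<open>Virtual twin groups\<close>

datatype vt_gen = S nat | Rho nat

definition vt_gens :: "nat \<Rightarrow> vt_gen set" where
  "vt_gens n = S ` {1..n - 1} \<union> Rho ` {1..n - 1}"

abbreviation pos_word :: "'a list \<Rightarrow> 'a word" where
  "pos_word \<equiv> map (\<lambda>a. (a, True))"

definition vt_relations :: "nat \<Rightarrow> (vt_gen list \<times> vt_gen list) set" where
  "vt_relations n =
     {([S i, S i], []) |i. i \<in> {1..n - 1}}
   \<union> {([Rho i, Rho i], []) |i. i \<in> {1..n - 1}}
   \<union> {([S i, S j], [S j, S i]) |i j.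
        i \<in> {1..n - 1} \<and> j \<in> {1..n - 1} \<and> \<bar>int i - int j\<bar> \<ge> 2}
   \<union> {([Rho i, Rho j], [Rho j, Rho i]) |i j.
        i \<in> {1..n - 1} \<and> j \<in> {1..n - 1} \<and> \<bar>int i - int j\<bar> \<ge> 2}
   \<union> {([Rho i, S j], [S j, Rho i]) |i j.
        i \<in> {1..n - 1} \<and> j \<in> {1..n - 1} \<and> \<bar>int i - int j\<bar> \<ge> 2}
   \<union> {([Rho i, Rho (i + 1), Rho i], [Rho (i + 1), Rho i, Rho (i + 1)]) |i. i \<in> {1..n - 2}}
   \<union> {([Rho i, Rho (i + 1), S i], [S (i + 1), Rho i, Rho (i + 1)]) |i. i \<in> {1..n - 2}}"

definition VT :: "nat \<Rightarrow> vt_gen word set monoid" where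
  "VT n = presented_group (vt_gens n) (map_prod pos_word pos_word ` vt_relations n)"

fun vt_gen_perm :: "vt_gen \<Rightarrow> nat \<Rightarrow> nat" where
  "vt_gen_perm (S i) = transpose i (i + 1)"
| "vt_gen_perm (Rho i) = transpose i (i + 1)"

definition vt_proj :: "nat \<Rightarrow> vt_gen word set \<Rightarrow> nat \<Rightarrow> nat" where
  "vt_proj n = pres_lift (sym_group n) vt_gen_perm"

definition PVT :: "nat \<Rightarrow> vt_gen word set monoid" where
  "PVT n = VT n\<lparr>carrier := kernel (VT n) (sym_group n) (vt_proj n)\<rparr>"

lemma vt_gen_perm_closed: "vt_gen_perm ` vt_gens n \<subseteq> carrier (sym_group n)"
  by (auto simp: vt_gens_def sym_group_carrier intro!: permutes_swap_id)

lemma transpose_far: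
  fixes i j :: nat
  assumes "\<bar>int i - int j\<bar> \<ge> 2"
  shows "transpose i (Suc i) \<circ> transpose j (Suc j) = transpose j (Suc j) \<circ> transpose i (Suc i)"
proof -
  have "i \<noteq> j" "i \<noteq> Suc j" "j \<noteq> Suc i" using assms by auto
  then show ?thesis by (auto simp: fun_eq_iff transpose_def)
qed

lemma transpose_braid:
  fixes i :: nat
  shows "transpose i (Suc i) \<circ> (transpose (Suc i) (Suc (Suc i)) \<circ> transpose i (Suc i))
    = transpose (Suc i) (Suc (Suc i)) \<circ> (transpose i (Suc i) \<circ> transpose (Suc i) (Suc (Suc i)))"
  by (auto simp: fun_eq_iff transpose_def)

lemma vt_gen_perm_relations:
  assumes "(r, s) \<in> map_prod pos_word pos_word ` vt_relations n"
  shows "eval_word (sym_group n) vt_gen_perm r = eval_word (sym_group n) vt_gen_perm s"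
  using assms
  unfolding vt_relations_def
  by (elim imageE UnE CollectE exE conjE)
    (simp_all add: sym_group_mult sym_group_one transpose_far transpose_braid)

lemma vt_proj_hom: "vt_proj n \<in> hom (VT n) (sym_group n)"
  unfolding vt_proj_def VT_def
  using sym_group_is_group vt_gen_perm_closed vt_gen_perm_relations by (rule pres_lift_hom)

lemma vt_proj_generator:
  assumes "a \<in> vt_gens n"
  shows "vt_proj n (pres_rel (vt_gens n) (map_prod pos_word pos_word ` vt_relations n) `` {[(a, True)]})
    = vt_gen_perm a"
  unfolding vt_proj_def
  using sym_group_is_group vt_gen_perm_closed vt_gen_perm_relations assms by (rule pres_lift_generator)

lemma group_PVT: "group (PVT n)"
proof -
  interpret group_hom "VT n" "sym_group n" "vt_proj n"
    using vt_proj_hom presented_group_is_group sym_group_is_group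
    by (simp add: group_hom_def group_hom_axioms_def VT_def)
  show ?thesis
    unfolding PVT_def using subgroup_kernel G.subgroup_imp_group by blast
qed


section \<open>Twisted conjugacy\<close>

definition twisted_conj :: "('a, 'b) monoid_scheme \<Rightarrow> ('a \<Rightarrow> 'a) \<Rightarrow> ('a \<times> 'a) set" where
  "twisted_conj G \<phi> =
    {(x, y). x \<in> carrier G \<and> y \<in> carrier G \<and>
       (\<exists>g\<in>carrier G. x = g \<otimes>\<^bsub>G\<^esub> y \<otimes>\<^bsub>G\<^esub> inv\<^bsub>G\<^esub> (\<phi> g))}"

definition R_infinity :: "('a, 'b) monoid_scheme \<Rightarrow> bool" where
  "R_infinity G \<longleftrightarrow> (\<forall>\<phi>\<in>auto G. infinite (carrier G // twisted_conj G \<phi>))"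

lemma equiv_twisted_conj:
  assumes "group G" "\<phi> \<in> hom G G"
  shows "equiv (carrier G) (twisted_conj G \<phi>)"
proof -
  interpret group_hom G G \<phi>
    using assms by (simp add: group_hom_def group_hom_axioms_def)
  show ?thesis
  proof (rule equivI)
    show "twisted_conj G \<phi> \<subseteq> carrier G \<times> carrier G"
      by (auto simp: twisted_conj_def)
    show "refl_on (carrier G) (twisted_conj G \<phi>)"
      by (rule refl_onI) (auto simp: twisted_conj_def intro!: bexI[of _ "\<one>\<^bsub>G\<^esub>"])
    show "sym (twisted_conj G \<phi>)"
    proof (rule symI)
      fix x y assume "(x, y) \<in> twisted_conj G \<phi>"
      then obtain g where g: "x \<in> carrier G" "y \<in> carrier G" "g \<in> carrier G"
        and x: "x = g \<otimes>\<^bsub>G\<^esub> y \<otimes>\<^bsub>G\<^esub> inv\<^bsub>G\<^esub> (\<phi> g)"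
        by (auto simp: twisted_conj_def)
      have "y = inv\<^bsub>G\<^esub> g \<otimes>\<^bsub>G\<^esub> x \<otimes>\<^bsub>G\<^esub> inv\<^bsub>G\<^esub> (\<phi> (inv\<^bsub>G\<^esub> g))"
        using g by (simp add: x G.m_assoc G.inv_solve_left)
      then show "(y, x) \<in> twisted_conj G \<phi>"
        using g G.inv_closed[OF g(3)] unfolding twisted_conj_def by blast
    qed
    show "trans (twisted_conj G \<phi>)"
    proof (rule transI)
      fix x y z assume "(x, y) \<in> twisted_conj G \<phi>" "(y, z) \<in> twisted_conj G \<phi>"
      then obtain g h where g: "x \<in> carrier G" "z \<in> carrier G" "g \<in> carrier G" "h \<in> carrier G"
        and x: "x = g \<otimes>\<^bsub>G\<^esub> (h \<otimes>\<^bsub>G\<^esub> z \<otimes>\<^bsub>G\<^esub> inv\<^bsub>G\<^esub> (\<phi> h)) \<otimes>\<^bsub>G\<^esub> inv\<^bsub>G\<^esub> (\<phi> g)"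
        by (auto simp: twisted_conj_def)
      have "x = (g \<otimes>\<^bsub>G\<^esub> h) \<otimes>\<^bsub>G\<^esub> z \<otimes>\<^bsub>G\<^esub> inv\<^bsub>G\<^esub> (\<phi> (g \<otimes>\<^bsub>G\<^esub> h))"
        using g by (simp add: x G.m_assoc G.inv_mult_group)
      then show "(x, z) \<in> twisted_conj G \<phi>"
        using g G.m_closed[OF g(3,4)] unfolding twisted_conj_def by blast
    qed
  qed
qed

end

theory Submission
  imports Defs Complex_Main "HOL-Algebra.Group_Action" "HOL-Algebra.SimpleGroups"
    "HOL-Algebra.Multiplicative_Group"
begin

text \<open>
  Let \<open>G\<close> be a finitely generated group and \<open>\<phi>\<close> an automorphism with \<open>r\<close> twisted conjugacy classes.
  On a finite quotient \<open>Q\<close> of \<open>G\<close> by a \<open>\<phi>\<close>-invariant subgroup, the orbit formula for the twisted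
  conjugation action reads \<open>1 = (\<Sum> 1 / |Stab|)\<close> with at most \<open>r\<close> summands, so all stabilisers have order
  bounded in terms of \<open>r\<close> alone. Now let \<open>T\<close> be a finite nonabelian simple quotient of \<open>G\<close> in which the
  elements of prime order \<open>p\<close> form one conjugacy class, and let \<open>K\<close> be the intersection of the
  kernels of all epimorphisms \<open>G \<rightarrow> T\<close>. By the Chinese remainder theorem some \<open>c \<in> G\<close> has image of
  order \<open>p\<close> under all these epimorphisms, and then \<open>\<phi>(c)\<close> is conjugate to \<open>c\<close> modulo \<open>K\<close>, say by \<open>h\<close>;
  hence \<open>\<langle>c\<rangle>\<close> stabilises \<open>h\<inverse>\<close> in \<open>G / K\<close>, and \<open>p\<close> is bounded in terms of \<open>r\<close>.

  For \<open>n \<ge> 3\<close> the group \<open>PVT_n\<close> maps onto a free group of rank 2, hence onto the alternating group of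
  degree \<open>p + 2\<close> for all primes \<open>p \<ge> 7\<close>, so that \<open>p\<close> is unbounded. For \<open>n = 2\<close> the
  group is cyclic and inversion has at most two twisted conjugacy classes.
\<close>


section \<open>Twisted conjugacy in finite groups\<close>

text \<open>The largest of at most \<open>Suc r\<close> unit fractions with sum \<open>q\<close> is
  at least \<open>q / Suc r\<close>, so its denominator has finitely many possible values. Removing
  it leaves finitely many problems with at most \<open>r\<close> terms.\<close>

lemma unit_fraction_bound:
  "\<exists>B. \<forall>(I :: 'i set) n. finite I \<longrightarrow> card I \<le> r \<longrightarrow> (\<forall>i\<in>I. n i > 0) \<longrightarrow>
     (\<Sum>i\<in>I. 1 / real (n i)) = q \<longrightarrow> (\<forall>i\<in>I. n i \<le> (B :: nat))"
proof (induction r arbitrary: q)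
  case 0
  then show ?case by (intro exI[of _ 0]) auto
next
  case (Suc r)
  obtain B' where B': "\<And>q (I :: 'i set) n. \<lbrakk>finite I; card I \<le> r; \<forall>i\<in>I. n i > 0;
      (\<Sum>i\<in>I. 1 / real (n i)) = q\<rbrakk> \<Longrightarrow> \<forall>i\<in>I. n i \<le> (B' q :: nat)"
    using Suc.IH by metis
  \<comment> \<open>\<open>D\<close> contains every possible denominator of the largest fraction; a
    denominator \<open>d\<close> leaves the sum \<open>q - 1 / d\<close> for the other
    terms.\<close>
  define D where "D = {..nat \<lfloor>real (Suc r) / q\<rfloor>}"
  define B where "B = Max (D \<union> (\<lambda>d. B' (q - 1 / real d)) ` D)"
  have fin: "finite (D \<union> (\<lambda>d. B' (q - 1 / real d)) ` D)" by (simp add: D_def)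
  show ?case
  proof (rule exI[of _ B], intro allI impI ballI)
    fix I :: "'i set" and n :: "'i \<Rightarrow> nat" and i
    assume I: "finite I" "card I \<le> Suc r" and pos: "\<forall>i\<in>I. n i > 0"
      and q: "(\<Sum>i\<in>I. 1 / real (n i)) = q" and i: "i \<in> I"
    have q0: "q > 0"
      unfolding q[symmetric] using I i pos by (intro sum_pos) auto
    have "\<exists>j\<in>I. q / real (Suc r) \<le> 1 / real (n j)"
    proof (rule ccontr)
      assume "\<not> ?thesis"
      then have "(\<Sum>i\<in>I. 1 / real (n i)) < (\<Sum>i\<in>I. q / real (Suc r))"
        using I i by (intro sum_strict_mono) auto
      also have "\<dots> = real (card I) * (q / real (Suc r))" by simp
      also have "\<dots> \<le> real (Suc r) * (q / real (Suc r))"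
        using I q0 by (intro mult_right_mono) auto
      finally show False using q by simp
    qed
    then obtain j where j: "j \<in> I" "q / real (Suc r) \<le> 1 / real (n j)" by blast
    have "real (n j) \<le> real (Suc r) / q"
      using j q0 pos by (auto simp: field_simps)
    then have jD: "n j \<in> D" unfolding D_def by (simp add: le_nat_floor)
    show "n i \<le> B"
    proof (cases "i = j")
      case True
      then show ?thesis using jD fin unfolding B_def by (intro Max_ge) auto
    next
      case False
      have "(\<Sum>i\<in>I - {j}. 1 / real (n i)) = q - 1 / real (n j)"
        using I j q by (simp add: sum_diff1)
      moreover have "card (I - {j}) \<le> r" using I j by simp
      ultimately have "n i \<le> B' (q - 1 / real (n j))"
        using B'[of "I - {j}" n] I pos i False by auto
      also have "\<dots> \<le> B" using jD fin unfolding B_def by (intro Max_ge) auto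
      finally show ?thesis .
    qed
  qed
qed

text \<open>Orbit-stabiliser theorem for the action of \<open>g\<close> by \<open>z\<close>
  \<mapsto> \<open>g z \<psi>(g)^-1\<close>, whose orbits are the twisted conjugacy classes.\<close>

lemma twisted_conj_class_card:
  assumes "group Q" "\<psi> \<in> hom Q Q" "finite (carrier Q)" "y \<in> carrier Q"
  shows "card (twisted_conj Q \<psi> `` {y})
      * card {g \<in> carrier Q. g \<otimes>\<^bsub>Q\<^esub> y \<otimes>\<^bsub>Q\<^esub> inv\<^bsub>Q\<^esub> \<psi> g = y} = card (carrier Q)"
proof -
  interpret group_hom Q Q \<psi>
    using assms by (simp add: group_hom_def group_hom_axioms_def)
  \<comment> \<open>The restriction to the carrier makes \<open>a g\<close> extensional, as
    membership in \<open>Bij\<close> demands.\<close>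
  define a where "a = (\<lambda>g. \<lambda>z\<in>carrier Q. g \<otimes>\<^bsub>Q\<^esub> z \<otimes>\<^bsub>Q\<^esub> inv\<^bsub>Q\<^esub> \<psi> g)"
  have comp: "a (g \<otimes>\<^bsub>Q\<^esub> h) = compose (carrier Q) (a g) (a h)"
    if "g \<in> carrier Q" "h \<in> carrier Q" for g h
    unfolding a_def compose_def using that
    by (intro restrict_ext) (simp add: G.m_assoc G.inv_mult_group)
  have one: "a \<one>\<^bsub>Q\<^esub> = (\<lambda>z\<in>carrier Q. z)"
    unfolding a_def by (intro restrict_ext) simp
  have a_in: "a g z \<in> carrier Q" if "g \<in> carrier Q" "z \<in> carrier Q" for g z
    using that by (simp add: a_def)
  have inv: "a g (a (inv\<^bsub>Q\<^esub> g) z) = z" "a (inv\<^bsub>Q\<^esub> g) (a g z) = z"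
    if "g \<in> carrier Q" "z \<in> carrier Q" for g z
    using that by (simp_all add: a_def G.m_assoc, simp_all flip: G.m_assoc)
  have bij: "a g \<in> Bij (carrier Q)" if "g \<in> carrier Q" for g
    unfolding Bij_def using inv[OF that] a_in[OF that] a_in[of "inv\<^bsub>Q\<^esub> g"] that
    by (auto intro!: bij_betw_byWitness[where f' = "a (inv\<^bsub>Q\<^esub> g)"]) (simp add: a_def)
  interpret act: group_action Q "carrier Q" a
    using assms(1) group_BijGroup bij comp
    by (intro group_action.intro group_hom.intro group_hom_axioms.intro homI)
      (simp_all add: BijGroup_def)
  have "orbit Q a y = twisted_conj Q \<psi> `` {y}"
  proof (intro equalityI subsetI)
    fix z assume "z \<in> orbit Q a y"
    then obtain g where "g \<in> carrier Q" "z = g \<otimes>\<^bsub>Q\<^esub> y \<otimes>\<^bsub>Q\<^esub> inv\<^bsub>Q\<^esub> \<psi> g"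
      using assms(4) by (auto simp: orbit_def a_def)
    then have "(z, y) \<in> twisted_conj Q \<psi>"
      using assms(4) by (auto simp: twisted_conj_def)
    then show "z \<in> twisted_conj Q \<psi> `` {y}"
      using equiv_twisted_conj[OF assms(1,2)] by (auto elim: equivE dest: symD)
  next
    fix z assume "z \<in> twisted_conj Q \<psi> `` {y}"
    then have "(z, y) \<in> twisted_conj Q \<psi>"
      using equiv_twisted_conj[OF assms(1,2)] by (auto elim: equivE dest: symD)
    then show "z \<in> orbit Q a y"
      by (auto simp: twisted_conj_def orbit_def a_def)
  qed
  moreover have "stabilizer Q a y = {g \<in> carrier Q. g \<otimes>\<^bsub>Q\<^esub> y \<otimes>\<^bsub>Q\<^esub> inv\<^bsub>Q\<^esub> \<psi> g = y}"
    using assms(4) by (auto simp: stabilizer_def a_def)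
  ultimately show ?thesis
    using act.orbit_stabilizer_theorem[OF assms(4)] by (simp add: order_def)
qed

text \<open>Dividing the class equation by the order of \<open>Q\<close> writes 1 as a sum of unit
  fractions, one for each class, whose denominators are the stabiliser orders.\<close>

lemma twisted_stabilizer_bound:
  "\<exists>B. \<forall>(Q :: ('a, 'b) monoid_scheme) \<psi> y. group Q \<longrightarrow> \<psi> \<in> hom Q Q \<longrightarrow> finite (carrier Q) \<longrightarrow>
     card (carrier Q // twisted_conj Q \<psi>) \<le> r \<longrightarrow> y \<in> carrier Q \<longrightarrow>
     card {g \<in> carrier Q. g \<otimes>\<^bsub>Q\<^esub> y \<otimes>\<^bsub>Q\<^esub> inv\<^bsub>Q\<^esub> \<psi> g = y} \<le> B"
proof -
  obtain B where B: "\<And>(I :: 'a set set) n. \<lbrakk>finite I; card I \<le> r; \<forall>i\<in>I. n i > 0;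
      (\<Sum>i\<in>I. 1 / real (n i)) = 1\<rbrakk> \<Longrightarrow> \<forall>i\<in>I. n i \<le> (B :: nat)"
    using unit_fraction_bound[where q = 1 and r = r and ?'i = "'a set"] by metis
  show ?thesis
  proof (rule exI[of _ B], intro allI impI)
    fix Q :: "('a, 'b) monoid_scheme" and \<psi> y
    assume Q: "group Q" "\<psi> \<in> hom Q Q" "finite (carrier Q)"
      and r: "card (carrier Q // twisted_conj Q \<psi>) \<le> r" and y: "y \<in> carrier Q"
    let ?I = "carrier Q // twisted_conj Q \<psi>"
    note eq = equiv_twisted_conj[OF Q(1,2)]
    \<comment> \<open>This division is exact by orbit-stabiliser: \<open>n C\<close> is the order of
      the stabiliser of any point of \<open>C\<close>.\<close>
    define n where "n C = card (carrier Q) div card C" for C :: "'a set"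
    have fin: "finite ?I"
      using Q(3) eq by (meson equivE finite_quotient)
    have Cn: "finite C \<and> card C > 0 \<and> card C * n C = card (carrier Q) \<and> n C > 0" if C: "C \<in> ?I" for C
    proof -
      obtain z where z: "z \<in> carrier Q" "C = twisted_conj Q \<psi> `` {z}"
        using C by (rule quotientE)
      have fC: "finite C" using C Q(3) eq by (meson finite_equiv_class equivE)
      moreover have "C \<noteq> {}" using C eq by (simp add: in_quotient_imp_non_empty)
      ultimately have pos: "card C > 0" by (simp add: card_gt_0_iff)
      have "card (carrier Q) > 0" using Q(3) y card_gt_0_iff by blast
      moreover obtain k where k: "card (carrier Q) = card C * k"
        using twisted_conj_class_card[OF Q z(1)] unfolding z(2)[symmetric] by metis
      ultimately show ?thesis
        using pos fC by (simp add: n_def)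
    qed
    have "(\<Sum>C\<in>?I. real (card C)) = real (card (\<Union>?I))"
      using Cn quotient_disj[OF eq] by (subst card_Union_disjoint) (auto simp: pairwise_def disjnt_def)
    also have "\<Union>?I = carrier Q" using Union_quotient[OF eq] .
    finally have "(\<Sum>C\<in>?I. real (card C)) / real (card (carrier Q)) = 1"
      using Q(3) y by auto
    moreover have "(\<Sum>C\<in>?I. real (card C)) / real (card (carrier Q)) = (\<Sum>C\<in>?I. 1 / real (n C))"
      unfolding sum_divide_distrib
    proof (intro sum.cong HOL.refl)
      fix C assume "C \<in> ?I"
      then have "real (card (carrier Q)) = real (card C) * real (n C)" "n C > 0" "card C > 0"
        using Cn by (simp_all flip: of_nat_mult)
      then show "real (card C) / real (card (carrier Q)) = 1 / real (n C)"
        by simp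
    qed
    ultimately have "\<forall>C\<in>?I. n C \<le> B"
      using B fin r Cn by simp
    moreover have C: "twisted_conj Q \<psi> `` {y} \<in> ?I" using y by (rule quotientI)
    ultimately have "n (twisted_conj Q \<psi> `` {y}) \<le> B" by blast
    moreover have "card C * k = card (carrier Q) \<Longrightarrow> card C > 0 \<Longrightarrow> k = n C" for C :: "'a set" and k
      unfolding n_def by (metis nonzero_mult_div_cancel_left not_gr_zero)
    ultimately show "card {g \<in> carrier Q. g \<otimes>\<^bsub>Q\<^esub> y \<otimes>\<^bsub>Q\<^esub> inv\<^bsub>Q\<^esub> \<psi> g = y} \<le> B"
      using twisted_conj_class_card[OF Q y] Cn[OF C] by simp
  qed
qed


section \<open>Simple quotients\<close>

definition epis :: "('a, 'b) monoid_scheme \<Rightarrow> ('c, 'd) monoid_scheme \<Rightarrow> ('a \<Rightarrow> 'c) set" where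
  "epis G T = {f \<in> hom G T. f ` carrier G = carrier T}"

lemma epis_group_hom: "group G \<Longrightarrow> group T \<Longrightarrow> f \<in> epis G T \<Longrightarrow> group_hom G T f"
  by (simp add: epis_def group_hom_def group_hom_axioms_def)

lemma epis_image_normal:
  assumes "group G" "simple_group T" "f \<in> epis G T" "N \<lhd> G"
  shows "f ` N = carrier T \<or> f ` N = {\<one>\<^bsub>T\<^esub>}"
proof -
  interpret simple_group T by fact
  interpret group_hom G T f
    using assms group_axioms by (intro epis_group_hom)
  show ?thesis
    using normal.surj_hom_normal_subgroup[OF assms(4) group_hom_axioms] assms(3)
    by (intro no_real_normal_subgroup) (auto simp: epis_def)
qed

text \<open>Kernels of epimorphisms onto a simple group are maximal normal subgroups, so neither of
  two distinct ones contains the other. Hence \<open>f\<close> does not kill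
  \<open>kernel G T f'\<close>, and the image, being normal, is everything.\<close>

lemma epis_kernel_image:
  assumes "group G" "simple_group T" "f \<in> epis G T" "f' \<in> epis G T"
    and "kernel G T f \<noteq> kernel G T f'"
  shows "f ` kernel G T f' = carrier T"
proof (rule ccontr)
  interpret simple_group T by fact
  interpret f: group_hom G T f
    using assms group_axioms by (intro epis_group_hom)
  interpret f': group_hom G T f'
    using assms group_axioms by (intro epis_group_hom)
  assume "f ` kernel G T f' \<noteq> carrier T"
  then have "f ` kernel G T f' = {\<one>\<^bsub>T\<^esub>}"
    using epis_image_normal[OF assms(1-3) f'.normal_kernel] by blast
  then have sub: "kernel G T f' \<subseteq> kernel G T f"
    by (auto simp: kernel_def)
  have "f' ` kernel G T f = carrier T"
  proof (rule ccontr)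
    assume "f' ` kernel G T f \<noteq> carrier T"
    then have "f' ` kernel G T f = {\<one>\<^bsub>T\<^esub>}"
      using epis_image_normal[OF assms(1,2,4) f.normal_kernel] by blast
    then have "kernel G T f \<subseteq> kernel G T f'"
      by (auto simp: kernel_def)
    then show False using sub assms(5) by blast
  qed
  then have "f g = \<one>\<^bsub>T\<^esub>" if g: "g \<in> carrier G" for g
  proof -
    obtain k where k: "k \<in> kernel G T f" "f' g = f' k"
      using \<open>f' ` kernel G T f = carrier T\<close> f'.hom_closed[OF g] by (metis imageE)
    then have kG: "k \<in> carrier G" "f k = \<one>\<^bsub>T\<^esub>" by (auto simp: kernel_def)
    then have "g \<otimes>\<^bsub>G\<^esub> inv\<^bsub>G\<^esub> k \<in> kernel G T f'"
      using k g by (simp add: kernel_def)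
    then have "g \<otimes>\<^bsub>G\<^esub> inv\<^bsub>G\<^esub> k \<in> kernel G T f" using sub by blast
    then show ?thesis using g kG by (simp add: kernel_def)
  qed
  then have "carrier T \<subseteq> {\<one>\<^bsub>T\<^esub>}"
    using assms(3) by (auto simp: epis_def)
  then show False using simple_not_triv by blast
qed

lemma normal_common_kernel:
  assumes "group G" "\<And>f. f \<in> F \<Longrightarrow> group_hom G T f"
  shows "{g \<in> carrier G. \<forall>f\<in>F. f g = \<one>\<^bsub>T\<^esub>} \<lhd> G" (is "?K \<lhd> G")
proof -
  interpret group G by fact
  have K: "g \<in> ?K \<longleftrightarrow> g \<in> carrier G \<and> (\<forall>f\<in>F. g \<in> kernel G T f)" for g
    by (auto simp: kernel_def)
  have sub: "subgroup (kernel G T f) G" and nor: "kernel G T f \<lhd> G" if "f \<in> F" for f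
    using assms(2)[OF that] by (simp_all add: group_hom.subgroup_kernel group_hom.normal_kernel)
  show ?thesis
    unfolding normal_inv_iff
  proof (intro conjI ballI)
    show "subgroup ?K G"
    proof (rule subgroupI)
      have "\<one>\<^bsub>G\<^esub> \<in> ?K" unfolding K using sub by (simp add: subgroup.one_closed)
      then show "?K \<noteq> {}" by blast
    qed (use sub in \<open>auto simp only: K subgroup.m_closed subgroup.m_inv_closed m_closed inv_closed\<close>)
  next
    fix g c assume "g \<in> carrier G" "c \<in> ?K"
    then show "g \<otimes>\<^bsub>G\<^esub> c \<otimes>\<^bsub>G\<^esub> inv\<^bsub>G\<^esub> g \<in> ?K"
      unfolding K using nor by (auto simp: normal_inv_iff)
  qed
qed

text \<open>A commutator of \<open>a\<close>, killed by \<open>F\<close>, and \<open>b\<close>,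
  killed by \<open>f'\<close>, is killed by \<open>insert f' F\<close>. Lifting the noncommuting
  \<open>x\<close> and \<open>y\<close> to such elements makes its image under \<open>f\<close>
  nontrivial, so simplicity gives all of \<open>T\<close>. For abelian groups this fails: three
  distinct kernels in (Z/p)^2 are a counterexample.\<close>

lemma epis_inter_kernel_image:
  assumes "group G" "simple_group T" "x \<in> carrier T" "y \<in> carrier T"
    and xy: "x \<otimes>\<^bsub>T\<^esub> y \<noteq> y \<otimes>\<^bsub>T\<^esub> x"
    and "f \<in> epis G T" "finite F" "F \<subseteq> epis G T"
    and "\<And>f'. f' \<in> F \<Longrightarrow> kernel G T f \<noteq> kernel G T f'"
  shows "f ` {g \<in> carrier G. \<forall>f'\<in>F. f' g = \<one>\<^bsub>T\<^esub>} = carrier T"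
  using assms(7-9)
proof (induction F)
  case empty
  then show ?case using assms(6) by (simp add: epis_def)
next
  case (insert f' F)
  interpret T: simple_group T by fact
  interpret f: group_hom G T f
    using assms T.group_axioms by (intro epis_group_hom)
  interpret f': group_hom G T f'
    using assms(1) insert.prems T.group_axioms by (intro epis_group_hom) auto
  let ?A = "{g \<in> carrier G. \<forall>f'\<in>F. f' g = \<one>\<^bsub>T\<^esub>}" and ?B = "kernel G T f'"
  let ?C = "{g \<in> carrier G. \<forall>f'\<in>insert f' F. f' g = \<one>\<^bsub>T\<^esub>}"
  have A: "f ` ?A = carrier T" using insert by simp
  have B: "f ` ?B = carrier T"
    using epis_kernel_image[OF assms(1,2,6)] insert.prems by blast
  obtain a where a: "a \<in> ?A" "f a = x" using A assms(3) by (metis (no_types, lifting) imageE)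
  obtain b where b: "b \<in> ?B" "f b = y" using B assms(4) by (metis (no_types, lifting) imageE)
  have hom: "group_hom G T f''" if "f'' \<in> insert f' F" for f''
    using that insert.prems assms(1) T.group_axioms
    by (auto simp: epis_def group_hom_def group_hom_axioms_def)
  have ab: "a \<in> carrier G" "b \<in> carrier G" "f' b = \<one>\<^bsub>T\<^esub>"
    using a b by (auto simp: kernel_def)
  let ?c = "a \<otimes>\<^bsub>G\<^esub> b \<otimes>\<^bsub>G\<^esub> inv\<^bsub>G\<^esub> a \<otimes>\<^bsub>G\<^esub> inv\<^bsub>G\<^esub> b"
  have "f'' ?c = \<one>\<^bsub>T\<^esub>" if "f'' \<in> insert f' F" for f''
  proof -
    interpret f'': group_hom G T f'' using hom[OF that] .
    have "f'' a = \<one>\<^bsub>T\<^esub> \<or> f'' b = \<one>\<^bsub>T\<^esub>" using that a ab by auto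
    then show ?thesis using ab by auto
  qed
  then have c: "?c \<in> ?C" using ab by auto
  have "f ?c \<noteq> \<one>\<^bsub>T\<^esub>"
  proof
    assume "f ?c = \<one>\<^bsub>T\<^esub>"
    then have "x \<otimes>\<^bsub>T\<^esub> y \<otimes>\<^bsub>T\<^esub> inv\<^bsub>T\<^esub> (y \<otimes>\<^bsub>T\<^esub> x) = \<one>\<^bsub>T\<^esub>"
      using a b ab assms(3,4) by (simp add: T.inv_mult_group T.m_assoc)
    then have "x \<otimes>\<^bsub>T\<^esub> y = y \<otimes>\<^bsub>T\<^esub> x"
      using assms(3,4) by (simp add: T.inv_solve_right')
    then show False using xy by blast
  qed
  moreover have "?C \<lhd> G"
    using assms(1) hom by (rule normal_common_kernel)
  ultimately show ?case
    using epis_image_normal[OF assms(1,2,6)] c by blast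
qed

text \<open>A Chinese remainder theorem. A solution \<open>g\<close> for \<open>F\<close> is
  multiplied by an element \<open>k\<close> killed by \<open>F\<close>; by
  \<open>epis_inter_kernel_image\<close> the value \<open>f k\<close> can be prescribed
  freely.\<close>

lemma epis_crt:
  assumes "group G" "simple_group T" "x \<in> carrier T" "y \<in> carrier T"
    and "x \<otimes>\<^bsub>T\<^esub> y \<noteq> y \<otimes>\<^bsub>T\<^esub> x"
    and "finite F" "F \<subseteq> epis G T" "inj_on (kernel G T) F" "t \<in> F \<rightarrow> carrier T"
  shows "\<exists>g\<in>carrier G. \<forall>f\<in>F. f g = t f"
  using assms(6-9)
proof (induction F)
  case empty
  interpret group G by fact
  show ?case by auto
next
  case (insert f F)
  interpret simple_group T by fact
  have hom: "group_hom G T f''" if "f'' \<in> insert f F" for f''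
    using that insert.prems assms(1) group_axioms
    by (auto simp: epis_def group_hom_def group_hom_axioms_def)
  interpret f: group_hom G T f using hom by simp
  obtain g where g: "g \<in> carrier G" "\<forall>f\<in>F. f g = t f"
    using insert by auto
  have "f ` {k \<in> carrier G. \<forall>f'\<in>F. f' k = \<one>\<^bsub>T\<^esub>} = carrier T"
    using insert by (intro epis_inter_kernel_image[OF assms(1-5)]) auto
  moreover have t: "t f' \<in> carrier T" if "f' \<in> insert f F" for f' using insert.prems that by auto
  then have "inv\<^bsub>T\<^esub> (f g) \<otimes>\<^bsub>T\<^esub> t f \<in> carrier T" using g by simp
  ultimately have "inv\<^bsub>T\<^esub> (f g) \<otimes>\<^bsub>T\<^esub> t f \<in> f ` {k \<in> carrier G. \<forall>f'\<in>F. f' k = \<one>\<^bsub>T\<^esub>}"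
    by blast
  then obtain k where k: "k \<in> carrier G" "\<And>f'. f' \<in> F \<Longrightarrow> f' k = \<one>\<^bsub>T\<^esub>"
    and fk: "f k = inv\<^bsub>T\<^esub> (f g) \<otimes>\<^bsub>T\<^esub> t f" by auto
  have "f (g \<otimes>\<^bsub>G\<^esub> k) = t f"
    using g k fk t by (simp flip: m_assoc)
  moreover have "f' (g \<otimes>\<^bsub>G\<^esub> k) = t f'" if "f' \<in> F" for f'
  proof -
    interpret f': group_hom G T f' using hom that by simp
    show ?thesis using that g k t by simp
  qed
  ultimately show ?case using g k by (intro bexI[of _ "g \<otimes>\<^bsub>G\<^esub> k"]) auto
qed

text \<open>A homomorphism is determined by its values on the finite set \<open>Y\<close>.
  Extensionality fixes its values outside the carrier, without which finiteness could fail.\<close>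

lemma finite_extensional_homs:
  assumes "group G" "group T" "finite Y" "Y \<subseteq> carrier G" "generate G Y = carrier G" "finite (carrier T)"
  shows "finite (hom G T \<inter> extensional (carrier G))"
proof (rule finite_imageD)
  have "(\<lambda>f. restrict f Y) ` (hom G T \<inter> extensional (carrier G)) \<subseteq> Y \<rightarrow>\<^sub>E carrier T"
    using assms(4) by (auto simp: hom_def)
  then show "finite ((\<lambda>f. restrict f Y) ` (hom G T \<inter> extensional (carrier G)))"
    using assms by (meson finite_PiE finite_subset)
  show "inj_on (\<lambda>f. restrict f Y) (hom G T \<inter> extensional (carrier G))"
  proof (rule inj_onI)
    fix f f' assume f: "f \<in> hom G T \<inter> extensional (carrier G)" "f' \<in> hom G T \<inter> extensional (carrier G)"
      and eq: "restrict f Y = restrict f' Y"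
    interpret f: group_hom G T f using f assms by (auto simp: group_hom_def group_hom_axioms_def)
    interpret f': group_hom G T f' using f assms by (auto simp: group_hom_def group_hom_axioms_def)
    have Y: "f y = f' y" if "y \<in> Y" for y using eq that by (metis restrict_apply')
    have "g \<in> carrier G \<and> f g = f' g" if "g \<in> generate G Y" for g
      using that
    proof (induction rule: generate.induct)
      case (incl h) then show ?case using Y assms(4) by auto
    next
      case (inv h) then show ?case using Y assms(4) by auto
    qed auto
    then show "f = f'"
      using f assms(5) by (auto intro: extensionalityI)
  qed
qed

section \<open>Passing to finite quotients\<close>

text \<open>As \<open>\<psi>\<close> is induced by \<open>\<phi>\<close>, the map \<open>q\<close>
  sends each class of \<open>\<phi>\<close> into one class of \<open>\<psi>\<close>, and every class
  of \<open>\<psi>\<close> is reached.\<close>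

lemma card_twisted_classes_le:
  assumes "group G" "\<phi> \<in> hom G G" "group Q" "\<psi> \<in> hom Q Q"
    and q: "q \<in> hom G Q" "q ` carrier G = carrier Q"
    and eq: "\<And>g. g \<in> carrier G \<Longrightarrow> \<psi> (q g) = q (\<phi> g)"
    and fin: "finite (carrier G // twisted_conj G \<phi>)"
  shows "card (carrier Q // twisted_conj Q \<psi>) \<le> card (carrier G // twisted_conj G \<phi>)"
proof (rule surj_card_le[OF fin])
  let ?h = "\<lambda>C. twisted_conj Q \<psi> `` (q ` C)"
  interpret q: group_hom G Q q
    using assms by (simp add: group_hom_def group_hom_axioms_def)
  interpret \<phi>: group_hom G G \<phi>
    using assms by (simp add: group_hom_def group_hom_axioms_def)
  note eG = equiv_twisted_conj[OF assms(1,2)] and eQ = equiv_twisted_conj[OF assms(3,4)]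
  show "carrier Q // twisted_conj Q \<psi> \<subseteq> ?h ` (carrier G // twisted_conj G \<phi>)"
  proof
    fix D assume "D \<in> carrier Q // twisted_conj Q \<psi>"
    then obtain y where "y \<in> carrier Q" "D = twisted_conj Q \<psi> `` {y}" by (rule quotientE)
    then obtain g where g: "g \<in> carrier G" "D = twisted_conj Q \<psi> `` {q g}" using q(2) by (metis imageE)
    have "twisted_conj Q \<psi> `` {q x} = D" if gx: "(g, x) \<in> twisted_conj G \<phi>" for x
    proof -
      obtain k where k: "k \<in> carrier G" "x \<in> carrier G" "g = k \<otimes>\<^bsub>G\<^esub> x \<otimes>\<^bsub>G\<^esub> inv\<^bsub>G\<^esub> (\<phi> k)"
        using gx by (auto simp: twisted_conj_def)
      then have "q g = q k \<otimes>\<^bsub>Q\<^esub> q x \<otimes>\<^bsub>Q\<^esub> inv\<^bsub>Q\<^esub> (\<psi> (q k))"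
        using eq by simp
      moreover have "q g \<in> carrier Q" using g by simp
      ultimately have "(q g, q x) \<in> twisted_conj Q \<psi>"
        using k by (auto simp: twisted_conj_def)
      then show ?thesis using equiv_class_eq[OF eQ] g by metis
    qed
    moreover have "(g, g) \<in> twisted_conj G \<phi>"
      using eG g by (auto elim!: equivE dest: refl_onD)
    ultimately have "D = ?h (twisted_conj G \<phi> `` {g})" by blast
    then show "D \<in> ?h ` (carrier G // twisted_conj G \<phi>)"
      using quotientI[OF g(1)] by blast
  qed
qed

lemma (in group) prime_order_pow_inj:
  assumes "x \<in> carrier G" "x \<noteq> \<one>" "x [^] (p :: nat) = \<one>" "prime p"
  shows "inj_on (\<lambda>k :: nat. x [^] k) {..<p}"
proof (rule inj_onI)
  have "ord x dvd p" using assms by (simp flip: pow_eq_id)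
  then have "ord x = p"
    using assms ord_eq_1 prime_nat_iff by blast
  fix i j :: nat
  assume ij: "i \<in> {..<p}" "j \<in> {..<p}" "x [^] i = x [^] j"
  then have "x [^] int i = x [^] int j" by (simp add: int_pow_int)
  then have "int p dvd int j - int i"
    using int_pow_eq[OF assms(1)] \<open>ord x = p\<close> by simp
  then show "i = j"
    using ij dvd_imp_le_int[of "int j - int i" "int p"] by fastforce
qed

text \<open>\<open>Q\<close> is the quotient by the common kernel of \<open>E\<close>. It is finite
  because a coset is determined by the tuple of values of all \<open>f\<close> in \<open>E\<close>.
  The last property is all that is used later, so cosets stay hidden.\<close>

lemma common_kernel_quotient:
  fixes G :: "('a, 'b) monoid_scheme" and T :: "('c, 'd) monoid_scheme"
  assumes "group G" "group T" and hom: "\<And>f. f \<in> E \<Longrightarrow> group_hom G T f" and fin: "finite E" "finite (carrier T)"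
  obtains Q :: "'a set monoid" and q where "group Q" "finite (carrier Q)" "q \<in> hom G Q" "q ` carrier G = carrier Q"
    "\<forall>g\<in>carrier G. \<forall>g'\<in>carrier G. q g = q g' \<longleftrightarrow> (\<forall>f\<in>E. f g = f g')"
proof -
  define K where "K = {g \<in> carrier G. \<forall>f\<in>E. f g = \<one>\<^bsub>T\<^esub>}"
  have "K \<lhd> G" unfolding K_def using assms(1) hom by (rule normal_common_kernel)
  then interpret normal K G .
  have q_eq: "K #>\<^bsub>G\<^esub> g = K #>\<^bsub>G\<^esub> g' \<longleftrightarrow> (\<forall>f\<in>E. f g = f g')"
    if g: "g \<in> carrier G" "g' \<in> carrier G" for g g'
  proof -
    have "K #>\<^bsub>G\<^esub> g = K #>\<^bsub>G\<^esub> g' \<longleftrightarrow> g \<in> K #>\<^bsub>G\<^esub> g'"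
      using g rcos_self[OF _ subgroup_axioms] repr_independence[OF _ _ subgroup_axioms] by metis
    also have "\<dots> \<longleftrightarrow> g \<otimes>\<^bsub>G\<^esub> inv\<^bsub>G\<^esub> g' \<in> K"
      using g assms(1) by (intro rcos_module)
    also have "\<dots> \<longleftrightarrow> (\<forall>f\<in>E. f (g \<otimes>\<^bsub>G\<^esub> inv\<^bsub>G\<^esub> g') = \<one>\<^bsub>T\<^esub>)"
      using g by (auto simp only: K_def mem_Collect_eq m_closed inv_closed)
    also have "\<dots> \<longleftrightarrow> (\<forall>f\<in>E. f g = f g')"
    proof (rule ball_cong[OF HOL.refl])
      fix f assume "f \<in> E"
      then interpret f: group_hom G T f by (rule hom)
      show "f (g \<otimes>\<^bsub>G\<^esub> inv\<^bsub>G\<^esub> g') = \<one>\<^bsub>T\<^esub> \<longleftrightarrow> f g = f g'"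
        using g by (simp add: f.H.inv_solve_right')
    qed
    finally show ?thesis .
  qed
  have "finite (carrier (G Mod K))"
  proof -
    let ?r = "\<lambda>g. \<lambda>f\<in>E. f g"
    have "?r ` carrier G \<subseteq> E \<rightarrow>\<^sub>E carrier T"
      using group_hom.hom_closed[OF hom] by auto
    then have finr: "finite (?r ` carrier G)"
      using fin by (meson finite_PiE finite_subset)
    have "K #>\<^bsub>G\<^esub> g = K #>\<^bsub>G\<^esub> g'" if "g \<in> carrier G" "g' \<in> carrier G" "?r g = ?r g'" for g g'
      unfolding q_eq[OF that(1,2)] using that(3) by (metis restrict_apply')
    then obtain d where d: "\<And>g. g \<in> carrier G \<Longrightarrow> K #>\<^bsub>G\<^esub> g = d (?r g)"
      using function_factors_left_gen[of "\<lambda>g. g \<in> carrier G" ?r "r_coset G K"] by blast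
    have "carrier (G Mod K) = d ` ?r ` carrier G"
      unfolding carrier_FactGroup image_image by (rule image_cong[OF HOL.refl d])
    then show ?thesis using finr by simp
  qed
  then show thesis
    using q_eq by (intro that[of "G Mod K" "r_coset G K"] factorgroup_is_group r_coset_hom_Mod)
      (simp_all add: carrier_FactGroup)
qed

lemma epi_factor:
  assumes "group G" "q \<in> hom G Q" "q ` carrier G = carrier Q" "h \<in> hom G H"
    and "\<And>g g'. \<lbrakk>g \<in> carrier G; g' \<in> carrier G; q g = q g'\<rbrakk> \<Longrightarrow> h g = h g'"
  obtains \<psi> where "\<psi> \<in> hom Q H" "\<And>g. g \<in> carrier G \<Longrightarrow> \<psi> (q g) = h g"
proof -
  interpret group G by fact
  obtain \<psi> where \<psi>: "\<And>g. g \<in> carrier G \<Longrightarrow> h g = \<psi> (q g)"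
    using assms(5) function_factors_left_gen[of "\<lambda>g. g \<in> carrier G" q h] by blast
  have "\<psi> \<in> hom Q H"
  proof (rule homI)
    fix x assume "x \<in> carrier Q"
    then obtain g where g: "g \<in> carrier G" "x = q g" using assms(3) by (metis imageE)
    then show "\<psi> x \<in> carrier H" using hom_in_carrier[OF assms(4)] by (simp flip: \<psi>)
    fix y assume "y \<in> carrier Q"
    then obtain k where k: "k \<in> carrier G" "y = q k" using assms(3) by (metis imageE)
    show "\<psi> (x \<otimes>\<^bsub>Q\<^esub> y) = \<psi> x \<otimes>\<^bsub>H\<^esub> \<psi> y"
      using g k hom_mult[OF assms(2) g(1) k(1)] hom_mult[OF assms(4) g(1) k(1)] \<psi>[of "g \<otimes>\<^bsub>G\<^esub> k"]
      by (simp add: \<psi>)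
  qed
  then show thesis using that \<psi> by metis
qed

text \<open>Since \<open>p\<close> is prime, the nontrivial solutions of \<open>u^p = 1\<close> are
  the elements of order \<open>p\<close>; the last clause makes them a single conjugacy class. This
  will force \<open>f c\<close> and \<open>f (\<phi> c)\<close> to be conjugate for every
  epimorphism \<open>f\<close>.\<close>

definition prime_fused :: "nat \<Rightarrow> ('a, 'b) monoid_scheme \<Rightarrow> bool" where
  "prime_fused p T \<longleftrightarrow> prime p \<and> simple_group T \<and> finite (carrier T)
    \<and> (\<exists>x\<in>carrier T. \<exists>y\<in>carrier T. x \<otimes>\<^bsub>T\<^esub> y \<noteq> y \<otimes>\<^bsub>T\<^esub> x)
    \<and> (\<exists>z\<in>carrier T. z \<noteq> \<one>\<^bsub>T\<^esub> \<and> z [^]\<^bsub>T\<^esub> p = \<one>\<^bsub>T\<^esub>)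
    \<and> (\<forall>u\<in>carrier T. \<forall>v\<in>carrier T. u \<noteq> \<one>\<^bsub>T\<^esub> \<longrightarrow> v \<noteq> \<one>\<^bsub>T\<^esub> \<longrightarrow>
         u [^]\<^bsub>T\<^esub> p = \<one>\<^bsub>T\<^esub> \<longrightarrow> v [^]\<^bsub>T\<^esub> p = \<one>\<^bsub>T\<^esub> \<longrightarrow>
         (\<exists>h\<in>carrier T. v = h \<otimes>\<^bsub>T\<^esub> u \<otimes>\<^bsub>T\<^esub> inv\<^bsub>T\<^esub> h))"

lemma quotient_with_large_stabilizer:
  fixes G :: "('a, 'b) monoid_scheme" and T :: "('c, 'd) monoid_scheme"
  assumes G: "group G" "finite Y" "Y \<subseteq> carrier G" "generate G Y = carrier G"
    and \<phi>: "\<phi> \<in> auto G"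
    and T: "prime_fused p T"
    and epi: "epis G T \<noteq> {}"
  obtains Q :: "'a set monoid" and \<psi> q w where "group Q" "finite (carrier Q)" "\<psi> \<in> hom Q Q"
    "q \<in> hom G Q" "q ` carrier G = carrier Q" "\<forall>g\<in>carrier G. \<psi> (q g) = q (\<phi> g)"
    "w \<in> carrier Q" "p \<le> card {g \<in> carrier Q. g \<otimes>\<^bsub>Q\<^esub> w \<otimes>\<^bsub>Q\<^esub> inv\<^bsub>Q\<^esub> \<psi> g = w}"
proof -
  interpret T: simple_group T using T by (simp add: prime_fused_def)
  have p: "prime p" and finT: "finite (carrier T)" using T by (auto simp: prime_fused_def)
  obtain x y where xy: "x \<in> carrier T" "y \<in> carrier T" "x \<otimes>\<^bsub>T\<^esub> y \<noteq> y \<otimes>\<^bsub>T\<^esub> x"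
    using T by (auto simp: prime_fused_def)
  obtain z where z: "z \<in> carrier T" "z \<noteq> \<one>\<^bsub>T\<^esub>" "z [^]\<^bsub>T\<^esub> p = \<one>\<^bsub>T\<^esub>"
    using T by (auto simp: prime_fused_def)
  have conj: "\<exists>h\<in>carrier T. v = h \<otimes>\<^bsub>T\<^esub> u \<otimes>\<^bsub>T\<^esub> inv\<^bsub>T\<^esub> h"
    if "u \<in> carrier T" "v \<in> carrier T" "u \<noteq> \<one>\<^bsub>T\<^esub>" "v \<noteq> \<one>\<^bsub>T\<^esub>" "u [^]\<^bsub>T\<^esub> p = \<one>\<^bsub>T\<^esub>" "v [^]\<^bsub>T\<^esub> p = \<one>\<^bsub>T\<^esub>" for u v
    using T that unfolding prime_fused_def by blast
  have "\<phi> \<in> hom G G" and \<phi>_surj: "\<phi> ` carrier G = carrier G"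
    using \<phi> by (auto simp: auto_def Bij_def bij_betw_def)
  interpret \<phi>: group_hom G G \<phi>
    using G(1) \<open>\<phi> \<in> hom G G\<close> by (simp add: group_hom_def group_hom_axioms_def)
  define E where "E = epis G T \<inter> extensional (carrier G)"
  have E_hom: "group_hom G T f" if "f \<in> E" for f
    using that epis_group_hom[OF G(1) T.group_axioms] by (auto simp: E_def)
  have finE: "finite E"
    using finite_extensional_homs[OF G(1) T.group_axioms G(2-4) finT]
    by (rule finite_subset[rotated]) (auto simp: E_def epis_def)
  \<comment> \<open>Precomposition with \<open>\<phi>\<close> keeps \<open>E\<close> invariant; this
    is why \<open>\<phi>\<close> descends to the quotient by the common kernel.\<close>
  have comp_E: "compose (carrier G) f \<phi> \<in> E" if "f \<in> E" for f
  proof -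
    have "compose (carrier G) f \<phi> ` carrier G = f ` carrier G"
      using \<phi>_surj by (force simp: compose_def)
    moreover have "compose (carrier G) f \<phi> \<in> hom G T"
      using E_hom[OF that] by (auto simp: hom_def compose_def group_hom.hom_closed group_hom.hom_mult)
    ultimately show ?thesis using that by (simp add: E_def epis_def)
  qed
  obtain f0 where f0: "f0 \<in> E"
  proof -
    obtain f where "f \<in> epis G T" using epi by blast
    then have "restrict f (carrier G) \<in> E"
      by (auto simp: E_def epis_def hom_def)
    then show thesis by (rule that)
  qed
  \<comment> \<open>\<open>F\<close> has one epimorphism for each kernel, because the Chinese
    remainder theorem asks for distinct kernels. Facts about which elements are killed then carry
    over from \<open>F\<close> to \<open>E\<close>.\<close>
  obtain F where F: "F \<subseteq> E" "inj_on (kernel G T) F" "kernel G T ` E = kernel G T ` F"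
    using subset_image_inj[of "kernel G T ` E" "kernel G T" E] by auto
  have kerF: "\<exists>f'\<in>F. kernel G T f = kernel G T f'" if "f \<in> E" for f
    using F(3) that by (metis imageE imageI)
  have crt: "\<exists>g\<in>carrier G. \<forall>f\<in>F. f g = t f" if "t \<in> F \<rightarrow> carrier T" for t
    using that finite_subset[OF F(1) finE] F by (intro epis_crt[OF G(1) T.simple_group_axioms xy]) (auto simp: E_def)
  obtain c where c: "c \<in> carrier G" "\<forall>f\<in>F. f c = z"
    using crt[of "\<lambda>_. z"] z by auto
  \<comment> \<open>Having an image of order \<open>p\<close> depends on the kernel only:
    \<open>c\<close> lies outside it and \<open>c^p\<close> inside.\<close>
  have ord_c: "f c \<noteq> \<one>\<^bsub>T\<^esub> \<and> f c [^]\<^bsub>T\<^esub> p = \<one>\<^bsub>T\<^esub>" if f: "f \<in> E" for f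
  proof -
    obtain f' where f': "f' \<in> F" "kernel G T f = kernel G T f'" using kerF f by blast
    interpret f: group_hom G T f using E_hom f .
    interpret f': group_hom G T f' using E_hom f' F by blast
    have "c \<notin> kernel G T f'" "c [^]\<^bsub>G\<^esub> p \<in> kernel G T f'"
      using c f' z by (auto simp: kernel_def f'.hom_nat_pow)
    then show ?thesis
      unfolding f'(2)[symmetric] using c by (auto simp: kernel_def f.hom_nat_pow)
  qed
  \<comment> \<open>Both \<open>f\<close> and its composite with \<open>\<phi>\<close> lie in
    \<open>E\<close>, so \<open>f c\<close> and \<open>f (\<phi> c)\<close> have order
    \<open>p\<close> and are conjugate.\<close>
  have "\<exists>h\<in>carrier T. f (\<phi> c) = h \<otimes>\<^bsub>T\<^esub> f c \<otimes>\<^bsub>T\<^esub> inv\<^bsub>T\<^esub> h" if "f \<in> E" for f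
    using conj[of "f c" "f (\<phi> c)"] ord_c[OF that] ord_c[OF comp_E[OF that]] c
      group_hom.hom_closed[OF E_hom[OF that]] by (simp add: compose_def)
  then obtain t where t: "\<And>f. f \<in> E \<Longrightarrow> t f \<in> carrier T \<and> f (\<phi> c) = t f \<otimes>\<^bsub>T\<^esub> f c \<otimes>\<^bsub>T\<^esub> inv\<^bsub>T\<^esub> (t f)"
    by metis
  \<comment> \<open>The conjugators \<open>t f\<close>, chosen separately for each \<open>f\<close>,
    are realised by one element \<open>h\<close> for all \<open>f\<close> in
    \<open>F\<close>.\<close>
  obtain h where h: "h \<in> carrier G" "\<forall>f\<in>F. f h = t f"
    using crt[of t] t F by blast
  obtain Q :: "'a set monoid" and q where Q: "group Q" and finQ: "finite (carrier Q)"
    and q_hom: "q \<in> hom G Q" and q_surj: "q ` carrier G = carrier Q"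
    and "\<forall>g\<in>carrier G. \<forall>g'\<in>carrier G. q g = q g' \<longleftrightarrow> (\<forall>f\<in>E. f g = f g')"
    using common_kernel_quotient[OF G(1) T.group_axioms E_hom finE finT] .
  then have q_eq: "q g = q g' \<longleftrightarrow> (\<forall>f\<in>E. f g = f g')" if "g \<in> carrier G" "g' \<in> carrier G" for g g'
    using that by blast
  interpret Q: group Q by fact
  interpret q: group_hom G Q q
    using G(1) Q q_hom by (simp add: group_hom_def group_hom_axioms_def)
  have "q (\<phi> g) = q (\<phi> g')" if g: "g \<in> carrier G" "g' \<in> carrier G" "q g = q g'" for g g'
  proof -
    have "f (\<phi> g) = f (\<phi> g')" if "f \<in> E" for f
    proof -
      have "compose (carrier G) f \<phi> g = compose (carrier G) f \<phi> g'"
        using q_eq[OF g(1,2)] g(3) comp_E[OF that] by blast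
      then show ?thesis using g by (simp add: compose_def)
    qed
    then show ?thesis using g by (subst q_eq) auto
  qed
  then obtain \<psi> where \<psi>: "\<psi> \<in> hom Q Q" "\<forall>g\<in>carrier G. \<psi> (q g) = q (\<phi> g)"
    using epi_factor[OF G(1) q_hom q_surj hom_compose[OF \<open>\<phi> \<in> hom G G\<close> q_hom]] unfolding comp_apply by metis
  have "q (\<phi> c) = q (h \<otimes>\<^bsub>G\<^esub> c \<otimes>\<^bsub>G\<^esub> inv\<^bsub>G\<^esub> h)"
  proof -
    let ?d = "\<phi> c \<otimes>\<^bsub>G\<^esub> inv\<^bsub>G\<^esub> (h \<otimes>\<^bsub>G\<^esub> c \<otimes>\<^bsub>G\<^esub> inv\<^bsub>G\<^esub> h)"
    have "f (\<phi> c) = f (h \<otimes>\<^bsub>G\<^esub> c \<otimes>\<^bsub>G\<^esub> inv\<^bsub>G\<^esub> h)" if f: "f \<in> E" for f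
    proof -
      obtain f' where f': "f' \<in> F" "kernel G T f = kernel G T f'" using kerF f by blast
      interpret f: group_hom G T f using E_hom f .
      interpret f': group_hom G T f' using E_hom f' F by blast
      have "f' (\<phi> c) = f' (h \<otimes>\<^bsub>G\<^esub> c \<otimes>\<^bsub>G\<^esub> inv\<^bsub>G\<^esub> h)"
        using t[of f'] f' F h c by auto
      then have "?d \<in> kernel G T f'"
        using c h by (simp add: kernel_def)
      then have "f ?d = \<one>\<^bsub>T\<^esub>"
        unfolding f'(2)[symmetric] by (simp add: kernel_def)
      then have "f (\<phi> c) \<otimes>\<^bsub>T\<^esub> inv\<^bsub>T\<^esub> f (h \<otimes>\<^bsub>G\<^esub> c \<otimes>\<^bsub>G\<^esub> inv\<^bsub>G\<^esub> h) = \<one>\<^bsub>T\<^esub>"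
        using c h f.hom_mult[of "\<phi> c" "inv\<^bsub>G\<^esub> (h \<otimes>\<^bsub>G\<^esub> c \<otimes>\<^bsub>G\<^esub> inv\<^bsub>G\<^esub> h)"]
          f.hom_inv[of "h \<otimes>\<^bsub>G\<^esub> c \<otimes>\<^bsub>G\<^esub> inv\<^bsub>G\<^esub> h"] by simp
      then show ?thesis
        using c h T.inv_solve_right'[of "\<one>\<^bsub>T\<^esub>" "f (\<phi> c)" "f (h \<otimes>\<^bsub>G\<^esub> c \<otimes>\<^bsub>G\<^esub> inv\<^bsub>G\<^esub> h)"] by simp
    qed
    then show ?thesis using c h by (subst q_eq) auto
  qed
  then have \<psi>c: "\<psi> (q c) = q h \<otimes>\<^bsub>Q\<^esub> q c \<otimes>\<^bsub>Q\<^esub> inv\<^bsub>Q\<^esub> q h"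
    using c h \<psi> by simp
  let ?w = "inv\<^bsub>Q\<^esub> q h"
  let ?St = "{g \<in> carrier Q. g \<otimes>\<^bsub>Q\<^esub> ?w \<otimes>\<^bsub>Q\<^esub> inv\<^bsub>Q\<^esub> \<psi> g = ?w}"
  interpret \<psi>: group_hom Q Q \<psi>
    using \<psi> Q.group_axioms by (simp add: group_hom_def group_hom_axioms_def)
  \<comment> \<open>The equation for \<open>\<psi> (q c)\<close> says that \<open>q c\<close> fixes
    \<open>?w\<close>, the inverse of \<open>q h\<close>, under twisted conjugation; hence so do its
    powers.\<close>
  have St: "q c [^]\<^bsub>Q\<^esub> k \<otimes>\<^bsub>Q\<^esub> ?w = ?w \<otimes>\<^bsub>Q\<^esub> \<psi> (q c [^]\<^bsub>Q\<^esub> k)" for k :: nat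
  proof (induction k)
    case 0
    then show ?case using h by simp
  next
    case (Suc k)
    have qc: "q c \<in> carrier Q" "q h \<in> carrier Q" using c h by auto
    then have "q c \<otimes>\<^bsub>Q\<^esub> ?w = ?w \<otimes>\<^bsub>Q\<^esub> \<psi> (q c)"
      unfolding \<psi>c by (simp flip: Q.m_assoc)
    then have "q c [^]\<^bsub>Q\<^esub> Suc k \<otimes>\<^bsub>Q\<^esub> ?w = q c [^]\<^bsub>Q\<^esub> k \<otimes>\<^bsub>Q\<^esub> ?w \<otimes>\<^bsub>Q\<^esub> \<psi> (q c)"
      using qc by (simp add: Q.m_assoc)
    also have "\<dots> = ?w \<otimes>\<^bsub>Q\<^esub> \<psi> (q c [^]\<^bsub>Q\<^esub> Suc k)"
      unfolding Suc.IH using qc by (simp add: Q.m_assoc)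
    finally show ?case .
  qed
  have "(\<lambda>k :: nat. q c [^]\<^bsub>Q\<^esub> k) ` {..<p} \<subseteq> ?St"
    using St c h by (auto simp: Q.m_assoc)
  \<comment> \<open>A single epimorphism \<open>f0\<close> separates the \<open>p\<close> powers,
    since \<open>f0 c\<close> has order \<open>p\<close>.\<close>
  moreover have "inj_on (\<lambda>k :: nat. q c [^]\<^bsub>Q\<^esub> k) {..<p}"
  proof (rule inj_onI)
    interpret f0: group_hom G T f0 using E_hom[OF f0] .
    fix i j :: nat assume ij: "i \<in> {..<p}" "j \<in> {..<p}" "q c [^]\<^bsub>Q\<^esub> i = q c [^]\<^bsub>Q\<^esub> j"
    then have "q (c [^]\<^bsub>G\<^esub> i) = q (c [^]\<^bsub>G\<^esub> j)" using c by (simp add: q.hom_nat_pow)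
    then have "f0 (c [^]\<^bsub>G\<^esub> i) = f0 (c [^]\<^bsub>G\<^esub> j)" using c f0 q_eq by simp
    then have "f0 c [^]\<^bsub>T\<^esub> i = f0 c [^]\<^bsub>T\<^esub> j" using c by (simp add: f0.hom_nat_pow)
    then show "i = j"
      using T.prime_order_pow_inj[of "f0 c" p] ord_c[OF f0] c p ij
      by (auto dest: inj_onD)
  qed
  ultimately have "p \<le> card ?St"
    using card_inj_on_le[of _ "{..<p}" ?St] finQ by simp
  then show thesis
    using that[OF Q finQ \<psi>(1) q_hom q_surj _ Q.inv_closed[OF q.hom_closed[OF h(1)]]] \<psi>(2) by blast
qed

text \<open>The quotients \<open>Q\<close> for all choices of \<open>T\<close> have the same type,
  so finitely many classes on \<open>G\<close> give one bound \<open>B\<close> for all their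
  stabilisers. A choice with \<open>p > B\<close> contradicts it.\<close>

theorem R_infinity_of_simple_quotients:
  fixes G :: "('a, 'b) monoid_scheme"
  assumes "group G" "finite Y" "Y \<subseteq> carrier G" "generate G Y = carrier G"
    and quot: "\<And>B. \<exists>p (T :: 'c monoid). B < p \<and> prime_fused p T \<and> epis G T \<noteq> {}"
  shows "R_infinity G"
  unfolding R_infinity_def
proof (intro ballI notI)
  fix \<phi> assume \<phi>: "\<phi> \<in> auto G" and fin: "finite (carrier G // twisted_conj G \<phi>)"
  then have hom: "\<phi> \<in> hom G G" by (simp add: auto_def)
  let ?r = "card (carrier G // twisted_conj G \<phi>)"
  obtain B where B: "\<forall>(Q :: 'a set monoid) \<psi> y. group Q \<longrightarrow> \<psi> \<in> hom Q Q \<longrightarrow> finite (carrier Q) \<longrightarrow>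
     card (carrier Q // twisted_conj Q \<psi>) \<le> ?r \<longrightarrow> y \<in> carrier Q \<longrightarrow>
     card {g \<in> carrier Q. g \<otimes>\<^bsub>Q\<^esub> y \<otimes>\<^bsub>Q\<^esub> inv\<^bsub>Q\<^esub> \<psi> g = y} \<le> B"
    using twisted_stabilizer_bound ..
  obtain p and T :: "'c monoid" where T: "B < p" "prime_fused p T" "epis G T \<noteq> {}"
    using quot[of B] by blast
  obtain Q :: "'a set monoid" and \<psi> q w where Q: "group Q" "finite (carrier Q)" "\<psi> \<in> hom Q Q"
    "q \<in> hom G Q" "q ` carrier G = carrier Q" "\<forall>g\<in>carrier G. \<psi> (q g) = q (\<phi> g)"
    "w \<in> carrier Q" "p \<le> card {g \<in> carrier Q. g \<otimes>\<^bsub>Q\<^esub> w \<otimes>\<^bsub>Q\<^esub> inv\<^bsub>Q\<^esub> \<psi> g = w}"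
    using quotient_with_large_stabilizer[OF assms(1-4) \<phi> T(2,3)] .
  have "card (carrier Q // twisted_conj Q \<psi>) \<le> ?r"
    using card_twisted_classes_le[OF assms(1) hom Q(1,3-5) _ fin] Q(6) by blast
  then have "card {g \<in> carrier Q. g \<otimes>\<^bsub>Q\<^esub> w \<otimes>\<^bsub>Q\<^esub> inv\<^bsub>Q\<^esub> \<psi> g = w} \<le> B"
    using B Q(1-3,7) by blast
  then show False using Q(8) T(1) by linarith
qed


section \<open>Alternating groups\<close>

text \<open>For distinct points this is x -> y -> z -> x, in the form to which
  \<open>cycle_of_list [x, y, z]\<close> unfolds.\<close>

definition cyc3 :: "'a \<Rightarrow> 'a \<Rightarrow> 'a \<Rightarrow> 'a \<Rightarrow> 'a" where
  "cyc3 x y z = transpose x y \<circ> transpose y z"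

lemma cyc3_rotate: "distinct [x, y, z] \<Longrightarrow> cyc3 x y z = cyc3 y z x"
  by (auto simp: cyc3_def fun_eq_iff transpose_def)

lemma cyc3_inverse: "cyc3 x y z \<circ> cyc3 z y x = id"
  by (auto simp: cyc3_def fun_eq_iff transpose_def)

lemma bij_cyc3: "bij (cyc3 x y z)"
  by (simp add: cyc3_def bij_comp)

lemma inv_cyc3: "inv' (cyc3 x y z) = cyc3 z y x"
  using cyc3_inverse inv_unique_comp by metis

lemma cyc3_conj: "bij s \<Longrightarrow> s \<circ> cyc3 x y z \<circ> inv' s = cyc3 (s x) (s y) (s z)"
proof -
  assume s: "bij s"
  have t: "s \<circ> transpose a b = transpose (s a) (s b) \<circ> s" for a b
    using bij_is_inj[OF s] by (auto simp: fun_eq_iff transpose_def inj_eq)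
  have "s \<circ> cyc3 x y z = cyc3 (s x) (s y) (s z) \<circ> s"
    unfolding cyc3_def by (metis comp_assoc t)
  then show ?thesis
    using surj_iff[THEN iffD1, OF bij_is_surj[OF s]] by (simp add: comp_assoc)
qed

text \<open>\<open>cyc3 a b c\<close> fixes \<open>x\<close>, \<open>y\<close> and \<open>z\<close>,
  so conjugating by it leaves \<open>cyc3 x y z\<close> unchanged.\<close>

lemma cyc3_commute:
  assumes "{x, y, z} \<inter> {a, b, c} = {}"
  shows "cyc3 x y z \<circ> cyc3 a b c = cyc3 a b c \<circ> cyc3 x y z"
proof -
  have "cyc3 a b c x = x" "cyc3 a b c y = y" "cyc3 a b c z = z"
    using assms by (auto simp: cyc3_def transpose_def)
  then have "cyc3 a b c \<circ> cyc3 x y z \<circ> inv' (cyc3 a b c) = cyc3 x y z"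
    by (simp add: cyc3_conj bij_cyc3)
  then show ?thesis
    by (metis bij_cyc3 bij_is_inj comp_assoc comp_id inv_o_cancel)
qed

lemma cyc3_in_alt:
  assumes "distinct [x, y, z]" "{x, y, z} \<subseteq> {1..n}"
  shows "cyc3 x y z \<in> carrier (alt_group n)"
proof -
  have "cyc3 x y z \<in> three_cycles n"
    using assms by (auto simp: cyc3_def intro!: exI[of _ "[x, y, z]"])
  then show ?thesis using three_cycles_incl by blast
qed

lemma alt_subgroup_eqI:
  assumes H: "subgroup H (alt_group n)"
    and cyc: "\<And>x y z. distinct [x, y, z] \<Longrightarrow> {x, y, z} \<subseteq> {1..n} \<Longrightarrow> cyc3 x y z \<in> H"
  shows "H = carrier (alt_group n)"
proof -
  interpret group "alt_group n" by (rule alt_group_is_group)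
  have "three_cycles n \<subseteq> H"
  proof
    fix c assume "c \<in> three_cycles n"
    then obtain cs where cs: "c = cycle_of_list cs" "cycle cs" "length cs = 3" "set cs \<subseteq> {1..n}"
      by auto
    then obtain x y z where "cs = [x, y, z]" using stupid_lemma by blast
    then show "c \<in> H" using cs cyc[of x y z] by (simp add: cyc3_def)
  qed
  then show ?thesis
    using generate_subgroup_incl[OF _ H] alt_group_carrier_as_three_cycles subgroup.subset[OF H] by blast
qed

context
  fixes n :: nat and H :: "(nat \<Rightarrow> nat) set"
  assumes H: "subgroup H (alt_group n)"
begin

lemma alt_subgroup_comp: "f \<in> H \<Longrightarrow> g \<in> H \<Longrightarrow> f \<circ> g \<in> H"
  using subgroup.m_closed[OF H] by (simp add: alt_group_mult)

lemma alt_subgroup_inv: "f \<in> H \<Longrightarrow> inv' f \<in> H"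
  using subgroup.m_inv_closed[OF H] subgroup.mem_carrier[OF H] by (metis alt_group_inv_equality)

lemma alt_subgroup_bij: "f \<in> H \<Longrightarrow> bij f"
  using subgroup.mem_carrier[OF H] by (metis alt_group_carrier permutes_bij)

lemma cyc3_conj_in: "f \<in> H \<Longrightarrow> cyc3 x y z \<in> H \<Longrightarrow> cyc3 (f x) (f y) (f z) \<in> H"
  using cyc3_conj[OF alt_subgroup_bij] alt_subgroup_comp alt_subgroup_inv by metis

lemma cyc3_rotate_in: "distinct [x, y, z] \<Longrightarrow> cyc3 x y z \<in> H \<Longrightarrow> cyc3 y z x \<in> H"
  using cyc3_rotate by metis

lemma cyc3_swap_in:
  assumes "distinct [x, y, z]" "cyc3 x y z \<in> H"
  shows "cyc3 y x z \<in> H"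
  using alt_subgroup_inv[OF assms(2)] cyc3_rotate[of z y x] assms(1) by (simp add: inv_cyc3)

text \<open>Conjugating (y z w) by the inverse of (x y z) gives (x y w). Conjugating it by (x y z)
  itself gives (z x w), whose inverse is (x z w).\<close>

lemma cyc3_exchange_in:
  assumes "distinct [x, y, z, w]" "cyc3 x y z \<in> H" "cyc3 y z w \<in> H"
  shows "cyc3 x y w \<in> H" "cyc3 x z w \<in> H"
proof -
  have "cyc3 z y x \<in> H" using alt_subgroup_inv[OF assms(2)] by (simp add: inv_cyc3)
  from cyc3_conj_in[OF this assms(3)] assms(1) show "cyc3 x y w \<in> H"
    by (simp add: cyc3_def transpose_def)
  from cyc3_conj_in[OF assms(2,3)] assms(1) have "cyc3 z x w \<in> H"
    by (simp add: cyc3_def transpose_def split: if_splits)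
  then show "cyc3 x z w \<in> H" using cyc3_swap_in assms(1) by auto
qed

text \<open>Increasing triples are reached by induction on the largest entry, through exchanges with
  consecutive triples. Any other 3-cycle is an increasing one up to rotation and inversion.\<close>

lemma alt_generated_by_consecutive:
  assumes "\<And>i. 1 \<le> i \<Longrightarrow> i + 2 \<le> n \<Longrightarrow> cyc3 i (i + 1) (i + 2) \<in> H"
  shows "H = carrier (alt_group n)"
proof (rule alt_subgroup_eqI[OF H])
  have sorted: "cyc3 x y z \<in> H" if "1 \<le> x" "x < y" "y < z" "z \<le> n" for x y z
    using that
  proof (induction z arbitrary: x y)
    case 0
    then show ?case by simp
  next
    case (Suc k)
    \<comment> \<open>Triples ending in \<open>k, Suc k\<close> come first: the exchange drops
      \<open>k - 1\<close> from (x, k-1, k) and (k-1, k, k+1).\<close>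
    have last: "cyc3 x k (Suc k) \<in> H" if x: "1 \<le> x" "x < k" for x
    proof (cases "x = k - 1")
      case True
      then show ?thesis using assms[of x] x Suc.prems by simp
    next
      case False
      have "cyc3 x (k - 1) k \<in> H" using Suc.IH[of x "k - 1"] x False Suc.prems by simp
      moreover have "cyc3 (k - 1) k (Suc k) \<in> H" using assms[of "k - 1"] x False Suc.prems by simp
      moreover have "distinct [x, k - 1, k, Suc k]" using x False by auto
      ultimately show ?thesis using cyc3_exchange_in(2) by blast
    qed
    show ?case
    proof (cases "y = k")
      case True
      then show ?thesis using last Suc.prems by simp
    next
      case False
      then have xy: "1 \<le> x" "x < y" "y < k" "k \<le> n" using Suc.prems by auto
      then have d: "distinct [x, y, k]" "distinct [y, x, k, Suc k]" "distinct [y, x, Suc k]" by auto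
      have "cyc3 y x k \<in> H"
        using cyc3_swap_in[OF d(1) Suc.IH[OF xy]] .
      moreover have "cyc3 x k (Suc k) \<in> H" using last xy by simp
      ultimately have "cyc3 y x (Suc k) \<in> H" by (rule cyc3_exchange_in(1)[OF d(2)])
      then show ?thesis by (rule cyc3_swap_in[OF d(3)])
    qed
  qed
  fix x y z :: nat assume d: "distinct [x, y, z]" and "{x, y, z} \<subseteq> {1..n}"
  then have b: "1 \<le> x" "1 \<le> y" "1 \<le> z" "x \<le> n" "y \<le> n" "z \<le> n" by auto
  \<comment> \<open>Swapping the first two entries inverts the cycle, so \<open>x < y\<close> may be
    assumed; only the position of \<open>z\<close> is left to distinguish.\<close>
  have wlog: "cyc3 x y z \<in> H"
    if c: "x < y" "distinct [x, y, z]" "1 \<le> x" "1 \<le> z" "y \<le> n" "z \<le> n" for x y z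
  proof -
    consider "y < z" | "x < z" "z < y" | "z < x" using c by fastforce
    then show ?thesis
    proof cases
      case 1
      then show ?thesis using sorted c by blast
    next
      case 2
      then have "cyc3 x z y \<in> H" using sorted c by blast
      from cyc3_rotate_in[OF _ cyc3_swap_in[OF _ this]] c 2 show ?thesis by auto
    next
      case 3
      then have "cyc3 z x y \<in> H" using sorted c by blast
      from cyc3_rotate_in[OF _ this] c 3 show ?thesis by auto
    qed
  qed
  show "cyc3 x y z \<in> H"
  proof (cases "x < y")
    case True
    then show ?thesis using wlog d b by blast
  next
    case False
    then have "y < x" using d by auto
    then have "cyc3 y x z \<in> H" using wlog[of y x z] d b by auto
    then show ?thesis using cyc3_swap_in d by auto
  qed
qed

end

section \<open>The long cycle and two generators of the alternating group\<close>

definition long_cycle :: "nat \<Rightarrow> nat \<Rightarrow> nat" where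
  "long_cycle n = cycle_of_list [1..<Suc n]"

text \<open>The points are 1, ..., n and the residues 0, ..., n - 1, hence the \<open>Suc\<close> on
  both sides.\<close>

lemma long_cycle_funpow:
  assumes "i < n"
  shows "(long_cycle n ^^ k) (Suc i) = Suc ((i + k) mod n)"
proof -
  have "map (long_cycle n ^^ k) [1..<Suc n] = rotate k [1..<Suc n]"
    unfolding long_cycle_def by (rule cyclic_rotation) simp
  then have "map (long_cycle n ^^ k) [1..<Suc n] ! i = rotate k [1..<Suc n] ! i" by simp
  moreover have "map (long_cycle n ^^ k) [1..<Suc n] ! i = (long_cycle n ^^ k) (Suc i)"
    using assms by (simp del: upt_Suc)
  moreover have "rotate k [1..<Suc n] ! i = Suc ((i + k) mod n)"
    using assms by (simp add: nth_rotate add.commute del: upt_Suc)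
  ultimately show ?thesis by simp
qed

lemma long_cycle_permutes: "long_cycle n permutes {1..n}"
  using cycle_permutes[of "[1..<Suc n]"] by (simp add: long_cycle_def atLeastLessThanSuc_atLeastAtMost del: upt_Suc)

lemma evenperm_long_cycle: "odd n \<Longrightarrow> evenperm (long_cycle n)"
  using swapidseq_ext_imp_swapidseq[OF swapidseq_ext_of_cycles[of "[1..<Suc n]"]]
  by (simp add: long_cycle_def evenperm_unique del: upt_Suc)

lemma long_cycle_in_alt: "odd m \<Longrightarrow> m \<le> n \<Longrightarrow> long_cycle m \<in> carrier (alt_group n)"
  using permutes_subset[OF long_cycle_permutes, of m "{1..n}"]
  by (simp add: alt_group_carrier evenperm_long_cycle)

text \<open>Conjugation by the long cycle moves (i, i+1, i+2) to the next consecutive triple, so all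
  of them arise from (1 2 3).\<close>

lemma alt_group_generated:
  assumes "odd n" "subgroup H (alt_group n)" "cyc3 1 2 3 \<in> H" "long_cycle n \<in> H"
  shows "H = carrier (alt_group n)"
proof (rule alt_generated_by_consecutive[OF assms(2)])
  fix i :: nat assume "1 \<le> i" "i + 2 \<le> n"
  then show "cyc3 i (i + 1) (i + 2) \<in> H"
  proof (induction i rule: dec_induct)
    case base
    then show ?case using assms(3) by (simp add: numeral_2_eq_2 numeral_3_eq_3)
  next
    case (step i)
    have s: "long_cycle n j = Suc j" if "1 \<le> j" "j < n" for j
      using long_cycle_funpow[of "j - 1" n 1] that by simp
    have "cyc3 i (i + 1) (i + 2) \<in> H" using step by simp
    from cyc3_conj_in[OF assms(2,4) this] step show ?case
      by (simp add: s)
  qed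
qed

lemma alt_group_noncommuting:
  assumes "n \<ge> 4"
  shows "\<exists>x\<in>carrier (alt_group n). \<exists>y\<in>carrier (alt_group n). x \<otimes>\<^bsub>alt_group n\<^esub> y \<noteq> y \<otimes>\<^bsub>alt_group n\<^esub> x"
proof (intro bexI)
  have "(cyc3 1 2 3 \<circ> cyc3 2 3 4) 1 \<noteq> (cyc3 2 3 4 \<circ> cyc3 1 2 (3 :: nat)) 1"
    by (simp add: cyc3_def transpose_def)
  then show "cyc3 1 2 3 \<otimes>\<^bsub>alt_group n\<^esub> cyc3 2 3 4 \<noteq> cyc3 2 3 4 \<otimes>\<^bsub>alt_group n\<^esub> cyc3 1 2 3"
    unfolding alt_group_mult by metis
qed (use assms in \<open>auto intro!: cyc3_in_alt\<close>)

section \<open>Simplicity of alternating groups on at least eight points\<close>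

text \<open>With \<open>t' = g t g^-1\<close>, the element \<open>k = t' t^-1\<close> lies in
  \<open>N\<close>, hence so does \<open>k^-1 (s k s^-1)\<close>. Because \<open>s\<close> commutes
  with \<open>t'\<close>, the factors \<open>t'\<close> cancel and [t, s] remains.\<close>

lemma (in group) commutator_in_normal:
  assumes N: "N \<lhd> G" and g: "g \<in> N" and car: "t \<in> carrier G" "s \<in> carrier G"
    and comm: "g \<otimes> t \<otimes> inv g \<otimes> s = s \<otimes> (g \<otimes> t \<otimes> inv g)"
  shows "t \<otimes> (s \<otimes> inv t \<otimes> inv s) \<in> N"
proof -
  interpret N: normal N G by fact
  have gG: "g \<in> carrier G" using g by (rule N.mem_carrier)
  define t' where "t' = g \<otimes> t \<otimes> inv g"
  have t': "t' \<in> carrier G" using gG car by (simp add: t'_def)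
  have k: "t' \<otimes> inv t \<in> N"
  proof -
    have "g \<otimes> (t \<otimes> inv g \<otimes> inv t) \<in> N"
      using g car by (intro N.m_closed N.inv_op_closed2 N.m_inv_closed)
    then show ?thesis using gG car by (simp add: t'_def m_assoc)
  qed
  have "inv (t' \<otimes> inv t) \<otimes> (s \<otimes> (t' \<otimes> inv t) \<otimes> inv s) \<in> N"
    using N.m_closed[OF N.m_inv_closed[OF k] N.inv_op_closed2[OF car(2) k]] .
  moreover have "inv (t' \<otimes> inv t) \<otimes> (s \<otimes> (t' \<otimes> inv t) \<otimes> inv s)
      = t \<otimes> inv t' \<otimes> (s \<otimes> t') \<otimes> inv t \<otimes> inv s"
    using car t' by (simp add: m_assoc inv_mult_group)
  moreover have "s \<otimes> t' = t' \<otimes> s" using comm by (simp add: t'_def)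
  moreover have "t \<otimes> inv t' \<otimes> (t' \<otimes> s) = t \<otimes> s"
    using car t' by (simp add: m_assoc) (simp flip: m_assoc)
  ultimately show ?thesis using car by (simp add: m_assoc)
qed

text \<open>
  For a 3-cycle \<open>\<tau>\<close> and \<open>g \<in> N\<close>, any \<open>\<sigma>\<close> commuting with \<open>g \<tau> g\<inverse>\<close> has \<open>[\<tau>, \<sigma>] \<in> N\<close>. With eight points
  available, \<open>\<sigma>\<close> can be a 3-cycle disjoint from \<open>g \<tau> g\<inverse>\<close> that meets \<open>\<tau>\<close> in a single point, and
  then \<open>[\<tau>, \<sigma>]\<close> is itself a 3-cycle; no case distinction on the cycle type of \<open>g\<close> is needed.
\<close>

lemma alt_normal_contains_cyc3:
  assumes n: "n \<ge> 8" and N: "N \<lhd> alt_group n" "N \<noteq> {id}"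
  obtains x y z where "distinct [x, y, z]" "{x, y, z} \<subseteq> {1..n}" "cyc3 x y z \<in> N"
proof -
  interpret A: group "alt_group n" by (rule alt_group_is_group)
  have sub: "subgroup N (alt_group n)" using N(1) by (simp add: normal_imp_subgroup)
  then have "id \<in> N" using subgroup.one_closed by (metis alt_group_one)
  then obtain g where g: "g \<in> N" "g \<noteq> id" using N(2) by blast
  then have perm: "g permutes {1..n}"
    using subgroup.mem_carrier[OF sub] by (metis alt_group_carrier)
  obtain x where x: "g x \<noteq> x" using g(2) by (auto simp: fun_eq_iff)
  then have xn: "x \<in> {1..n}" using perm by (metis permutes_not_in)
  note inj = permutes_inj[OF perm]
  \<comment> \<open>The choices below avoid at most seven listed points, so eight points
    suffice.\<close>
  have pick: "\<exists>y\<in>{1..n}. y \<notin> set ys" if "length ys < 8" for ys :: "nat list"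
  proof (rule ccontr)
    assume "\<not> ?thesis"
    then have "{1..n} \<subseteq> set ys" by auto
    then have "n \<le> card (set ys)" using card_mono[OF finite_set] by fastforce
    then show False using card_length[of ys] that n by linarith
  qed
  \<comment> \<open>Avoiding the preimage of \<open>x\<close> under \<open>g\<close> keeps
    \<open>x\<close> out of the support {g x, g y, g z} of the conjugated 3-cycle.\<close>
  obtain y where y: "y \<in> {1..n}" "y \<notin> set [x, inv' g x]" using pick[of "[x, inv' g x]"] by auto
  obtain z where z: "z \<in> {1..n}" "z \<notin> set [x, y, inv' g x]" using pick[of "[x, y, inv' g x]"] by auto
  obtain u where u: "u \<in> {1..n}" "u \<notin> set [x, y, z, g x, g y, g z]"
    using pick[of "[x, y, z, g x, g y, g z]"] by auto
  obtain v where v: "v \<in> {1..n}" "v \<notin> set [x, y, z, g x, g y, g z, u]"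
    using pick[of "[x, y, z, g x, g y, g z, u]"] by auto
  have gyz: "g y \<noteq> x" "g z \<noteq> x" using y z inv_f_f[OF inj] by fastforce+
  have gin: "g w \<in> {1..n}" if "w \<in> {1..n}" for w using permutes_in_image[OF perm] that by blast
  have car: "cyc3 x y z \<in> carrier (alt_group n)" "cyc3 x u v \<in> carrier (alt_group n)"
    using xn y z u v by (auto intro!: cyc3_in_alt)
  have gcar: "g \<in> carrier (alt_group n)" using subgroup.mem_carrier[OF sub g(1)] .
  have "g \<circ> cyc3 x y z \<circ> inv' g \<circ> cyc3 x u v = cyc3 x u v \<circ> (g \<circ> cyc3 x y z \<circ> inv' g)"
    unfolding cyc3_conj[OF permutes_bij[OF perm]] using x gyz u v by (intro cyc3_commute) auto
  then have "cyc3 x y z \<circ> (cyc3 x u v \<circ> inv' (cyc3 x y z) \<circ> inv' (cyc3 x u v)) \<in> N"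
    using A.commutator_in_normal[OF N(1) g(1) car]
    by (simp only: alt_group_mult alt_group_inv_equality[OF gcar] alt_group_inv_equality[OF car(1)]
        alt_group_inv_equality[OF car(2)])
  then have "cyc3 x y z \<circ> (cyc3 x u v \<circ> cyc3 z y x \<circ> inv' (cyc3 x u v)) \<in> N"
    by (simp only: inv_cyc3)
  \<comment> \<open>The second factor of the commutator is (z y u), and (x y z)(z y u) = (x y
    u).\<close>
  moreover have "cyc3 x u v \<circ> cyc3 z y x \<circ> inv' (cyc3 x u v) = cyc3 z y u"
  proof -
    have "cyc3 x u v x = u" "cyc3 x u v y = y" "cyc3 x u v z = z"
      using y z u v by (auto simp: cyc3_def transpose_def)
    then show ?thesis by (simp add: cyc3_conj[OF bij_cyc3])
  qed
  moreover have "cyc3 x y z \<circ> cyc3 z y u = cyc3 x y u"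
    using x y z u by (auto simp: cyc3_def transpose_def fun_eq_iff)
  ultimately have "cyc3 x y u \<in> N" by simp
  then show thesis using that[of x y u] xn y u by auto
qed

text \<open>A nontrivial normal subgroup contains one 3-cycle; conjugating by 3-cycles exchanges its
  entries one at a time until every 3-cycle is reached.\<close>

lemma alt_group_simple:
  assumes n: "n \<ge> 8"
  shows "simple_group (alt_group n)"
proof -
  interpret A: group "alt_group n" by (rule alt_group_is_group)
  have card: "order (alt_group n) > 1"
  proof -
    have "2 < (fact n :: nat)" using n fact_ge_self[of n] by linarith
    then show ?thesis
      using alt_group_card_carrier[of n] n by (simp add: order_def)
  qed
  have "N = carrier (alt_group n) \<or> N = {\<one>\<^bsub>alt_group n\<^esub>}" if N: "N \<lhd> alt_group n" for N
  proof (rule disjCI)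
    assume "N \<noteq> {\<one>\<^bsub>alt_group n\<^esub>}"
    then obtain x y z where xyz: "distinct [x, y, z]" "{x, y, z} \<subseteq> {1..n}" "cyc3 x y z \<in> N"
      using alt_normal_contains_cyc3[OF n N] by (metis alt_group_one)
    have sub: "subgroup N (alt_group n)" using N by (simp add: normal_imp_subgroup)
    \<comment> \<open>With a fifth point \<open>v\<close>, conjugation by (z w v) replaces the third
      entry \<open>z\<close> by \<open>w\<close> and fixes \<open>x\<close> and
      \<open>y\<close>.\<close>
    have step: "cyc3 x y w \<in> N"
      if "distinct [x, y, z]" "{x, y, z} \<subseteq> {1..n}" "cyc3 x y z \<in> N" "w \<in> {1..n}" "w \<notin> {x, y}" for x y z w
    proof (cases "w = z")
      case False
      have "\<not> {1..n} \<subseteq> {x, y, z, w}"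
      proof
        assume "{1..n} \<subseteq> {x, y, z, w}"
        then have "n \<le> card {x, y, z, w}" using card_mono[of "{x, y, z, w}" "{1..n}"] by simp
        also have "\<dots> \<le> 4" using card_length[of "[x, y, z, w]"] by simp
        finally show False using n by simp
      qed
      then obtain v where v: "v \<in> {1..n}" "v \<notin> {x, y, z, w}" by blast
      have s: "cyc3 z w v \<in> carrier (alt_group n)"
        using that False v by (intro cyc3_in_alt) auto
      have "cyc3 z w v \<otimes>\<^bsub>alt_group n\<^esub> cyc3 x y z \<otimes>\<^bsub>alt_group n\<^esub> inv\<^bsub>alt_group n\<^esub> cyc3 z w v \<in> N"
        using N s that(3) by (simp add: normal.inv_op_closed2)
      then have "cyc3 z w v \<circ> cyc3 x y z \<circ> inv' (cyc3 z w v) \<in> N"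
        using s by (simp add: alt_group_mult alt_group_inv_equality)
      moreover have "cyc3 z w v x = x" "cyc3 z w v y = y" "cyc3 z w v z = w"
        using that False v by (auto simp: cyc3_def transpose_def)
      ultimately show ?thesis by (simp add: cyc3_conj[OF bij_cyc3])
    qed (use that in simp)
    have front: "\<exists>z. distinct [w, x, z] \<and> {w, x, z} \<subseteq> {1..n} \<and> cyc3 w x z \<in> N"
      if "distinct [x, y, z]" "{x, y, z} \<subseteq> {1..n}" "cyc3 x y z \<in> N" "w \<in> {1..n}" "w \<noteq> x" for x y z w
    proof (cases "w = y")
      case True
      then show ?thesis using that cyc3_swap_in[OF sub that(1,3)] by (intro exI[of _ z]) auto
    next
      case False
      have "cyc3 x y w \<in> N" using step[OF that(1-4)] that(5) False by simp
      then have "cyc3 w x y \<in> N" using cyc3_rotate[of w x y] that False by auto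
      then show ?thesis using that False by (intro exI[of _ y]) auto
    qed
    \<comment> \<open>First \<open>b\<close> and then \<open>a\<close> is brought to the front, and
      finally the third entry is replaced by \<open>c\<close>.\<close>
    have "cyc3 a b c \<in> N" if abc: "distinct [a, b, c]" "{a, b, c} \<subseteq> {1..n}" for a b c
    proof -
      have "\<exists>y z. distinct [b, y, z] \<and> {b, y, z} \<subseteq> {1..n} \<and> cyc3 b y z \<in> N"
        using front[OF xyz, of b] xyz abc by (cases "b = x") auto
      then obtain y z where "distinct [b, y, z]" "{b, y, z} \<subseteq> {1..n}" "cyc3 b y z \<in> N" by blast
      from front[OF this, of a] obtain z where z: "distinct [a, b, z]" "{a, b, z} \<subseteq> {1..n}" "cyc3 a b z \<in> N"
        using abc by auto
      from step[OF z, of c] show ?thesis using abc by auto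
    qed
    then show "N = carrier (alt_group n)" by (rule alt_subgroup_eqI[OF sub])
  qed
  then show ?thesis using card by unfold_locales
qed

section \<open>Conjugacy of elements of prime order\<close>

lemma alt_group_pow: "u [^]\<^bsub>alt_group n\<^esub> (k :: nat) = u ^^ k"
  by (induction k) (simp_all add: alt_group_one alt_group_mult funpow_swap1 fun_eq_iff)

lemma transpose_fixed_comm:
  assumes "inj u" "u a = a" "u b = b"
  shows "u \<circ> transpose a b = transpose a b \<circ> u"
  using assms by (auto simp: fun_eq_iff transpose_def inj_eq)

text \<open>Every nontrivial cycle of \<open>u\<close> has length \<open>p\<close>, and a second one
  would not fit into the two points left over by the first. So \<open>u\<close> is a
  \<open>p\<close>-cycle with two fixed points; \<open>e\<close> lists the cycle and then these
  points.\<close>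

lemma prime_order_enumeration:
  assumes u: "u permutes A" "card A = p + 2" "u ^^ p = id" "u \<noteq> id" and p: "prime p" "p > 2"
  obtains e where "bij_betw e {..<p + 2} A" "\<And>i. i < p \<Longrightarrow> u (e i) = e (Suc i mod p)"
    "u (e p) = e p" "u (e (Suc p)) = e (Suc p)"
proof -
  have finA: "finite A" using u(2) by (simp add: card_ge_0_finite)
  have perm: "permutation u" using u(1) finA permutation_permutes by blast
  \<comment> \<open>\<open>least_power u w\<close> is the length of the cycle through
    \<open>w\<close>; it divides the prime \<open>p\<close>.\<close>
  have lp: "least_power u w = p" if "u w \<noteq> w" for w
  proof -
    have "least_power u w dvd p" using u(3) by (intro least_power_minimal) simp
    moreover have "least_power u w \<noteq> 1"
      using least_power_of_permutation(1)[OF perm, of w] that by auto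
    ultimately show ?thesis using p prime_nat_iff by blast
  qed
  obtain x where x: "u x \<noteq> x" using u(4) by (auto simp: fun_eq_iff)
  have sup: "set (support u w) \<subseteq> A" "card (set (support u w)) = p" "w \<in> set (support u w)"
    if w: "u w \<noteq> w" for w
  proof -
    have "w \<in> A" using u(1) w by (metis permutes_not_in)
    then show "set (support u w) \<subseteq> A"
      using permutes_in_image[OF permutes_funpow[OF u(1)]] by auto
    show "card (set (support u w)) = p"
      using cycle_of_permutation[OF perm, of w] distinct_card lp[OF w] by fastforce
    show "w \<in> set (support u w)"
      using lp[OF w] p by (auto intro!: image_eqI[of _ _ 0])
  qed
  let ?O = "set (support u x)"
  have "card (A - ?O) = 2"
    using sup(1,2)[OF x] finA u(2) by (simp add: card_Diff_subset finite_subset)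
  then obtain a b where ab: "A - ?O = {a, b}" "a \<noteq> b" by (auto simp: card_2_iff)
  have fixed: "u w = w" if w: "w \<in> A - ?O" for w
  proof (rule ccontr)
    assume uw: "u w \<noteq> w"
    have "set (support u w) \<inter> ?O = {}"
      using disjoint_support[OF perm] sup(3)[OF uw] w by (auto simp: disjoint_def)
    then have "set (support u w) \<subseteq> A - ?O" using sup(1)[OF uw] by blast
    then have "p \<le> 2"
      using card_mono[of "A - ?O" "set (support u w)"] finA sup(2)[OF uw] \<open>card (A - ?O) = 2\<close> by simp
    then show False using p by simp
  qed
  define e where "e i = (if i < p then (u ^^ i) x else if i = p then a else b)" for i
  have O: "?O = e ` {..<p}"
    using lp[OF x] by (auto simp: e_def atLeast0LessThan)
  have "e ` {..<p + 2} = A"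
  proof -
    have "{..<p + 2} = {..<p} \<union> {p, Suc p}" by auto
    then have "e ` {..<p + 2} = ?O \<union> {a, b}" by (simp only: O image_Un) (auto simp: e_def)
    then show ?thesis using ab sup(1)[OF x] by blast
  qed
  then have "bij_betw e {..<p + 2} A"
    unfolding bij_betw_def using u(2) by (simp add: eq_card_imp_inj_on)
  moreover have "u (e i) = e (Suc i mod p)" if "i < p" for i
  proof (cases "Suc i = p")
    case True
    then have "u (e i) = (u ^^ p) x" by (auto simp: e_def)
    then show ?thesis using u(3) True p by (simp add: e_def)
  qed (use that in \<open>simp add: e_def\<close>)
  moreover have "u (e p) = e p" "u (e (Suc p)) = e (Suc p)"
    using fixed ab by (auto simp: e_def)
  ultimately show thesis using that by blast
qed

text \<open>
  The two points outside the \<open>p\<close>-cycle are there to correct the parity: their transposition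
  centralises \<open>u\<close>, so the conjugating permutation can be chosen even.
\<close>

lemma alt_group_prime_order_conj:
  assumes p: "prime p" "p > 2"
    and u: "u \<in> carrier (alt_group (p + 2))" "u ^^ p = id" "u \<noteq> id"
    and v: "v \<in> carrier (alt_group (p + 2))" "v ^^ p = id" "v \<noteq> id"
  shows "\<exists>h\<in>carrier (alt_group (p + 2)). v = h \<circ> u \<circ> inv' h"
proof -
  let ?A = "{1..p + 2}"
  have pu: "u permutes ?A" and pv: "v permutes ?A" using u v by (auto simp: alt_group_carrier)
  obtain e where e: "bij_betw e {..<p + 2} ?A" "\<And>i. i < p \<Longrightarrow> u (e i) = e (Suc i mod p)"
    "u (e p) = e p" "u (e (Suc p)) = e (Suc p)"
    using prime_order_enumeration[OF pu _ u(2,3) p] by auto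
  obtain d where d: "bij_betw d {..<p + 2} ?A" "\<And>i. i < p \<Longrightarrow> v (d i) = d (Suc i mod p)"
    "v (d p) = d p" "v (d (Suc p)) = d (Suc p)"
    using prime_order_enumeration[OF pv _ v(2,3) p] by auto
  \<comment> \<open>\<open>h\<close> carries the enumeration for \<open>u\<close> to the one for
    \<open>v\<close>, so it intertwines the two permutations.\<close>
  define h where "h z = (if z \<in> ?A then d (inv_into {..<p + 2} e z) else z)" for z
  have he: "h (e i) = d i" if "i < p + 2" for i
    using that e(1) by (auto simp: h_def bij_betw_def inv_into_f_f)
  have "bij_betw (d \<circ> inv_into {..<p + 2} e) ?A ?A"
    using bij_betw_inv_into[OF e(1)] d(1) by (rule bij_betw_trans)
  then have ph: "h permutes ?A"
    using bij_betw_cong[of ?A h "d \<circ> inv_into {..<p + 2} e" ?A]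
    by (intro bij_imp_permutes) (auto simp: h_def simp del: atLeastAtMost_iff)
  have hu: "h \<circ> u = v \<circ> h"
  proof
    fix z
    show "(h \<circ> u) z = (v \<circ> h) z"
    proof (cases "z \<in> ?A")
      case True
      then obtain i where i: "i < p + 2" "z = e i" using e(1) unfolding bij_betw_def by blast
      consider "i < p" | "i = p" | "i = Suc p" using i by linarith
      then show ?thesis
      proof cases
        case 1
        then have "Suc i mod p < p + 2" using mod_less_divisor[of p "Suc i"] p by linarith
        then show ?thesis using 1 i e d he by simp
      qed (use i e d he in auto)
    next
      case False
      then show ?thesis using pu pv ph by (simp add: permutes_not_in)
    qed
  qed
  define t where "t = transpose (e p) (e (Suc p))"
  have "e p \<noteq> e (Suc p)" using inj_on_eq_iff[OF bij_betw_imp_inj_on[OF e(1)], of p "Suc p"] by simp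
  moreover have "e p \<in> ?A" "e (Suc p) \<in> ?A" using e(1) by (auto simp: bij_betw_def)
  ultimately have t: "t permutes ?A" "\<not> evenperm t"
    by (simp_all add: t_def permutes_swap_id evenperm_swap)
  have tu: "u \<circ> t = t \<circ> u"
    unfolding t_def using permutes_inj[OF pu] e by (intro transpose_fixed_comm)
  define k where "k = (if evenperm h then h else h \<circ> t)"
  have "permutation h" "permutation t"
    using ph t(1) permutation_permutes by blast+
  then have k: "k \<in> carrier (alt_group (p + 2))"
    using ph t by (auto simp: k_def alt_group_carrier evenperm_comp permutes_compose)
  have "k \<circ> u = v \<circ> k"
    using hu tu by (simp add: k_def) (metis comp_assoc)
  moreover have "k \<circ> inv' k = id"
    using k by (metis alt_group_carrier permutes_inv_o(1))
  ultimately have "v = k \<circ> u \<circ> inv' k" by (simp add: comp_assoc)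
  then show ?thesis using k by blast
qed

text \<open>The degree \<open>p + 2\<close> is within reach of \<open>alt_group_simple\<close>, and
  \<open>long_cycle p\<close>, even because \<open>p\<close> is odd, serves as an element of order
  \<open>p\<close>.\<close>

lemma alt_group_prime_fused:
  assumes p: "prime p" "p \<ge> 7"
  shows "prime_fused p (alt_group (p + 2))"
proof -
  have p2: "p > 2" using p by simp
  have "odd p" using p prime_odd_nat by simp
  then have z: "long_cycle p \<in> carrier (alt_group (p + 2))" by (rule long_cycle_in_alt) simp
  have "(long_cycle p ^^ p) j = j" for j
  proof (cases "j \<in> {1..p}")
    case True
    then obtain i where "j = Suc i" "i < p" by (cases j) auto
    then show ?thesis using long_cycle_funpow[of i p p] by simp
  next
    case False
    then show ?thesis using permutes_not_in[OF permutes_funpow[OF long_cycle_permutes]] by blast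
  qed
  then have "long_cycle p ^^ p = id" by auto
  moreover have "long_cycle p 1 \<noteq> 1" using long_cycle_funpow[of 0 p 1] p2 by simp
  then have "long_cycle p \<noteq> id" by auto
  moreover have "finite (carrier (alt_group (p + 2)))"
    by (rule finite_subset[of _ "{f. f permutes {1..p + 2}}"]) (auto simp: alt_group_carrier finite_permutations)
  moreover have "\<exists>h\<in>carrier (alt_group (p + 2)).
      v = h \<otimes>\<^bsub>alt_group (p + 2)\<^esub> u \<otimes>\<^bsub>alt_group (p + 2)\<^esub> inv\<^bsub>alt_group (p + 2)\<^esub> h"
    if "u \<in> carrier (alt_group (p + 2))" "v \<in> carrier (alt_group (p + 2))"
      "u \<noteq> id" "v \<noteq> id" "u ^^ p = id" "v ^^ p = id" for u v
    using alt_group_prime_order_conj[OF p(1) p2 that(1,5,3,2,6,4)] alt_group_inv_equality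
    unfolding alt_group_mult by metis
  ultimately show ?thesis
    unfolding prime_fused_def alt_group_pow alt_group_one
    using p z alt_group_simple[of "p + 2"] alt_group_noncommuting[of "p + 2"] by auto
qed


section \<open>Pure virtual twin groups\<close>

text \<open>Schreier's lemma: the kernel has finite index, and its cosets correspond to the values
  of \<open>\<pi>\<close>.\<close>

lemma generate_hom_kernel_finite:
  assumes "group_hom G H \<pi>" "finite (carrier H)" "finite X" "X \<subseteq> carrier G" "generate G X = carrier G"
  obtains Y where "finite Y" "Y \<subseteq> kernel G H \<pi>"
    "generate (G\<lparr>carrier := kernel G H \<pi>\<rparr>) Y = kernel G H \<pi>"
proof -
  interpret group_hom G H \<pi> by fact
  \<comment> \<open>The choice \<open>t 1 = 1\<close> gives \<open>y 1 g = g\<close> for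
    \<open>g\<close> in the kernel, so elements of the kernel need no correction at the end.\<close>
  define t where "t h = (if h = \<one>\<^bsub>H\<^esub> then \<one>\<^bsub>G\<^esub> else inv_into (carrier G) \<pi> h)" for h
  have t: "t h \<in> carrier G \<and> \<pi> (t h) = h" if "h \<in> \<pi> ` carrier G" for h
    using that by (auto simp: t_def inv_into_into f_inv_into_f)
  have img: "h \<otimes>\<^bsub>H\<^esub> \<pi> g \<in> \<pi> ` carrier G" if "h \<in> \<pi> ` carrier G" "g \<in> carrier G" for h g
    using that by (auto simp flip: hom_mult)
  \<comment> \<open>Including inverses of generators lets the induction over \<open>generate\<close>
    treat inverse letters like the others.\<close>
  define X' where "X' = X \<union> m_inv G ` X"
  \<comment> \<open>the Schreier generators for the transversal \<open>t\<close>\<close>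
  define y where "y h g = t h \<otimes>\<^bsub>G\<^esub> g \<otimes>\<^bsub>G\<^esub> inv\<^bsub>G\<^esub> t (h \<otimes>\<^bsub>H\<^esub> \<pi> g)" for h g
  define Y where "Y = case_prod y ` (\<pi> ` carrier G \<times> X')"
  have X': "X' \<subseteq> carrier G" "finite X'" using assms by (auto simp: X'_def)
  have "\<pi> ` carrier G \<subseteq> carrier H" by auto
  then have "finite Y" unfolding Y_def using X' assms(2) finite_subset by blast
  have y_ker: "y h g \<in> kernel G H \<pi>" if "h \<in> \<pi> ` carrier G" "g \<in> carrier G" for h g
  proof -
    have "h \<in> carrier H" using that by auto
    then show ?thesis
      using that t[OF that(1)] t[OF img[OF that]] by (simp add: y_def kernel_def)
  qed
  then have "Y \<subseteq> kernel G H \<pi>" using X' by (auto simp: Y_def)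
  have Y_car: "Y \<subseteq> carrier G" using \<open>Y \<subseteq> kernel G H \<pi>\<close> by (auto simp: kernel_def)
  have gen: "y h g \<in> generate G Y" if "g \<in> generate G X" "h \<in> \<pi> ` carrier G" for g h
    using that
  proof (induction arbitrary: h rule: generate.induct)
    case one
    then have "h \<in> carrier H" by auto
    then show ?case using t[OF one] by (simp add: y_def generate.one)
  next
    case (incl g)
    then show ?case by (auto simp: Y_def X'_def intro!: generate.incl)
  next
    case (inv g)
    then show ?case by (auto simp: Y_def X'_def intro!: generate.incl)
  next
    case (eng g1 g2)
    have g: "g1 \<in> carrier G" "g2 \<in> carrier G" "h \<in> carrier H" using eng.hyps eng.prems assms(5) by auto
    have h1: "h \<otimes>\<^bsub>H\<^esub> \<pi> g1 \<in> \<pi> ` carrier G" using img eng.prems g by blast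
    \<comment> \<open>Cocycle identity: the representative inserted after \<open>g1\<close>
      cancels.\<close>
    have "y h (g1 \<otimes>\<^bsub>G\<^esub> g2) = y h g1 \<otimes>\<^bsub>G\<^esub> y (h \<otimes>\<^bsub>H\<^esub> \<pi> g1) g2"
    proof -
      have "inv\<^bsub>G\<^esub> t (h \<otimes>\<^bsub>H\<^esub> \<pi> g1) \<otimes>\<^bsub>G\<^esub> (t (h \<otimes>\<^bsub>H\<^esub> \<pi> g1) \<otimes>\<^bsub>G\<^esub> z) = z" if "z \<in> carrier G" for z
        using t[OF h1] that by (simp flip: G.m_assoc)
      then show ?thesis
        using g t[OF eng.prems] t[OF h1] t[OF img[OF h1 g(2)]] by (simp add: y_def G.m_assoc H.m_assoc)
    qed
    then show ?case using eng.IH(1)[OF eng.prems] eng.IH(2)[OF h1] by (simp add: generate.eng)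
  qed
  have "kernel G H \<pi> \<subseteq> generate G Y"
  proof
    fix g assume g: "g \<in> kernel G H \<pi>"
    then have "g \<in> carrier G" "\<pi> g = \<one>\<^bsub>H\<^esub>" by (auto simp: kernel_def)
    moreover have "\<one>\<^bsub>H\<^esub> \<in> \<pi> ` carrier G" by (metis G.one_closed hom_one imageI)
    ultimately show "g \<in> generate G Y"
      using gen[of g "\<one>\<^bsub>H\<^esub>"] assms(5) by (simp add: y_def t_def)
  qed
  moreover have "generate G Y \<subseteq> kernel G H \<pi>"
    using G.generate_subgroup_incl[OF \<open>Y \<subseteq> kernel G H \<pi>\<close> subgroup_kernel] .
  ultimately have "generate (G\<lparr>carrier := kernel G H \<pi>\<rparr>) Y = kernel G H \<pi>"
    using G.generate_consistent[OF \<open>Y \<subseteq> kernel G H \<pi>\<close> subgroup_kernel] by simp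
  then show thesis using that \<open>finite Y\<close> \<open>Y \<subseteq> kernel G H \<pi>\<close> by blast
qed

lemma presented_group_Cons:
  assumes "l \<in> X \<times> UNIV" "w \<in> lists (X \<times> UNIV)"
  shows "pres_rel X R `` {l # w} = pres_rel X R `` {[l]} \<otimes>\<^bsub>presented_group X R\<^esub> pres_rel X R `` {w}"
  using presented_group_mult[of "[l]" X w R] assms by simp

lemma presented_group_inv_letter:
  assumes "a \<in> X"
  shows "inv\<^bsub>presented_group X R\<^esub> (pres_rel X R `` {[(a, True)]}) = pres_rel X R `` {[(a, False)]}"
proof -
  interpret group "presented_group X R" by (rule presented_group_is_group)
  have "([(a, False), (a, True)], []) \<in> pres_rel X R"
    using pres_rel.cancel[OF assms, of "[]" "[]" False R] by simp
  then have "pres_rel X R `` {[(a, False), (a, True)]} = pres_rel X R `` {[]}"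
    by (rule equiv_class_eq[OF equiv_pres_rel])
  moreover have "pres_rel X R `` {[(a, False), (a, True)]}
      = pres_rel X R `` {[(a, False)]} \<otimes>\<^bsub>presented_group X R\<^esub> pres_rel X R `` {[(a, True)]}"
    using assms by (intro presented_group_Cons) auto
  moreover have "\<one>\<^bsub>presented_group X R\<^esub> = pres_rel X R `` {[]}"
    by (simp add: presented_group_def)
  ultimately have "pres_rel X R `` {[(a, False)]} \<otimes>\<^bsub>presented_group X R\<^esub> pres_rel X R `` {[(a, True)]}
      = \<one>\<^bsub>presented_group X R\<^esub>"
    by simp
  then show ?thesis using assms by (intro inv_equality presented_group_carrierI) auto
qed

lemma presented_group_generate:
  "generate (presented_group X R) ((\<lambda>a. pres_rel X R `` {[(a, True)]}) ` X) = carrier (presented_group X R)"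
  (is "generate ?G ?Y = _")
proof -
  interpret group ?G by (rule presented_group_is_group)
  have Y: "?Y \<subseteq> carrier ?G" by (auto intro!: presented_group_carrierI)
  have "pres_rel X R `` {w} \<in> generate ?G ?Y" if "w \<in> lists (X \<times> UNIV)" for w
    using that
  proof (induction w)
    case Nil
    show ?case using generate.one[of ?G ?Y] by (simp add: presented_group_def)
  next
    case (Cons l w)
    obtain a b where l: "l = (a, b)" by fastforce
    have "a \<in> X" using Cons l by auto
    then have Y_mem: "pres_rel X R `` {[(a, True)]} \<in> ?Y" by (rule imageI)
    have letter: "pres_rel X R `` {[l]} \<in> generate ?G ?Y"
    proof (cases b)
      case True
      then show ?thesis using generate.incl[OF Y_mem, of ?G] l by simp
    next
      case False
      then show ?thesis
        using generate.inv[OF Y_mem, of ?G] presented_group_inv_letter[OF \<open>a \<in> X\<close>, of R] l by simp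
    qed
    have "pres_rel X R `` {l # w} = pres_rel X R `` {[l]} \<otimes>\<^bsub>?G\<^esub> pres_rel X R `` {w}"
      using Cons.hyps Cons.prems by (intro presented_group_Cons) auto
    then show ?case using generate.eng[OF letter Cons.IH] Cons.hyps by simp
  qed
  then have "A \<in> generate ?G ?Y" if "A \<in> carrier ?G" for A
    using that by (elim presented_group_carrierE) simp
  then show ?thesis using generate_incl[OF Y] by (intro equalityI subsetI) auto
qed

section \<open>Words for elements of the pure virtual twin group\<close>

abbreviation vt_class :: "nat \<Rightarrow> vt_gen word \<Rightarrow> vt_gen word set" where
  "vt_class n w \<equiv> pres_rel (vt_gens n) (map_prod pos_word pos_word ` vt_relations n) `` {w}"

lemma vt_proj_class:
  "w \<in> lists (vt_gens n \<times> UNIV) \<Longrightarrow> vt_proj n (vt_class n w) = eval_word (sym_group n) vt_gen_perm w"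
  unfolding vt_proj_def
  using sym_group_is_group vt_gen_perm_closed vt_gen_perm_relations by (rule pres_lift_class)

lemma group_VT: "group (VT n)"
  unfolding VT_def by (rule presented_group_is_group)

lemma vt_proj_group_hom: "group_hom (VT n) (sym_group n) (vt_proj n)"
  using vt_proj_hom group_VT sym_group_is_group by (simp add: group_hom_def group_hom_axioms_def)

lemma vt_class_mult:
  "u \<in> lists (vt_gens n \<times> UNIV) \<Longrightarrow> v \<in> lists (vt_gens n \<times> UNIV) \<Longrightarrow>
    vt_class n u \<otimes>\<^bsub>VT n\<^esub> vt_class n v = vt_class n (u @ v)"
  unfolding VT_def by (rule presented_group_mult)

lemma PVT_mult: "x \<otimes>\<^bsub>PVT n\<^esub> y = x \<otimes>\<^bsub>VT n\<^esub> y"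
  by (simp add: PVT_def)

lemma PVT_carrierE:
  assumes "A \<in> carrier (PVT n)"
  obtains w where "w \<in> lists (vt_gens n \<times> UNIV)" "A = vt_class n w"
    "eval_word (sym_group n) vt_gen_perm w = id"
proof -
  have "A \<in> carrier (VT n)" "vt_proj n A = id"
    using assms by (auto simp: PVT_def kernel_def sym_group_one)
  then show thesis using vt_proj_class that unfolding VT_def by (metis presented_group_carrierE)
qed

lemma PVT_carrierI:
  "w \<in> lists (vt_gens n \<times> UNIV) \<Longrightarrow> eval_word (sym_group n) vt_gen_perm w = id \<Longrightarrow>
    vt_class n w \<in> carrier (PVT n)"
  using vt_proj_class presented_group_carrierI
  by (simp add: PVT_def kernel_def sym_group_one VT_def del: in_lists_conv_set)

lemma PVT_finitely_generated:
  obtains Y where "finite Y" "Y \<subseteq> carrier (PVT n)" "generate (PVT n) Y = carrier (PVT n)"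
proof -
  have "finite (carrier (sym_group n))"
    by (simp add: sym_group_def finite_permutations)
  moreover have "finite (vt_gens n)" by (simp add: vt_gens_def)
  moreover have "(\<lambda>a. vt_class n [(a, True)]) ` vt_gens n \<subseteq> carrier (VT n)"
    unfolding VT_def by (auto intro!: presented_group_carrierI)
  ultimately obtain Y where "finite Y" "Y \<subseteq> kernel (VT n) (sym_group n) (vt_proj n)"
    "generate (PVT n) Y = kernel (VT n) (sym_group n) (vt_proj n)"
    using generate_hom_kernel_finite[OF vt_proj_group_hom _ finite_imageI _
        presented_group_generate[of "vt_gens n" "map_prod pos_word pos_word ` vt_relations n", folded VT_def], folded PVT_def]
    by blast
  then show thesis using that[of Y] by (simp add: PVT_def)
qed

text \<open>
  An element of \<open>PVT_n\<close> is a product of the generators \<open>\<lambda>\<^bsub>i,j\<^esub>\<close>, the conjugates of \<open>s_k \<rho>_k\<close> under the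
  subgroup \<open>S_n\<close> generated by the \<open>\<rho>_k\<close>. A letter acts (from the right) on pairs \<open>(\<sigma>, h)\<close>, where \<open>\<sigma>\<close>
  is the permutation of the word read so far and \<open>h\<close> the product of the labels \<open>l i j\<close> assigned to the
  \<open>\<lambda>\<^bsub>i,j\<^esub>\<close> met so far. All letters act as involutions, so the sign of a letter is irrelevant.
\<close>

fun vt_act :: "(nat \<Rightarrow> nat \<Rightarrow> 'a \<Rightarrow> 'a) \<Rightarrow> vt_gen \<times> bool \<Rightarrow> (nat \<Rightarrow> nat) \<times> ('a \<Rightarrow> 'a)
    \<Rightarrow> (nat \<Rightarrow> nat) \<times> ('a \<Rightarrow> 'a)" where
  "vt_act l (S i, b) (\<sigma>, h) = (\<sigma> \<circ> transpose i (i + 1), h \<circ> l (\<sigma> i) (\<sigma> (i + 1)))"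
| "vt_act l (Rho i, b) (\<sigma>, h) = (\<sigma> \<circ> transpose i (i + 1), h)"

lemma vt_act_fst: "fst (vt_act l (a, b) s) = fst s \<circ> vt_gen_perm a"
  by (cases a; cases s) auto

lemma vt_gen_perm_involution: "vt_gen_perm a \<circ> vt_gen_perm a = id"
  by (cases a) auto

lemma fold_vt_act_fst:
  assumes "w \<in> lists (vt_gens n \<times> UNIV)"
  shows "fst (fold (vt_act l) w s) = fst s \<circ> eval_word (sym_group n) vt_gen_perm w"
  using assms
proof (induction w arbitrary: s)
  case Nil
  then show ?case by (simp add: sym_group_one)
next
  case (Cons x w)
  obtain a b where x: "x = (a, b)" by fastforce
  have "vt_gen_perm a \<in> carrier (sym_group n)" using Cons.hyps x vt_gen_perm_closed by auto
  moreover have "inv' (vt_gen_perm a) = vt_gen_perm a"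
    using vt_gen_perm_involution inv_unique_comp by metis
  ultimately have "(if b then vt_gen_perm a else inv\<^bsub>sym_group n\<^esub> vt_gen_perm a) = vt_gen_perm a"
    by simp
  then show ?case using Cons by (simp add: x vt_act_fst sym_group_mult comp_assoc)
qed

lemma vt_act_snd: "vt_act l x (\<sigma>, h) = (fst (vt_act l x (\<sigma>, id)), h \<circ> snd (vt_act l x (\<sigma>, id)))"
  by (cases "(l, x, (\<sigma>, h))" rule: vt_act.cases) auto

text \<open>Labels are appended on the right of \<open>h\<close> and depend only on the permutation,
  so the starting value of \<open>h\<close> stays as a left factor.\<close>

lemma fold_vt_act_snd:
  "fold (vt_act l) w (\<sigma>, h) = (fst (fold (vt_act l) w (\<sigma>, id)), h \<circ> snd (fold (vt_act l) w (\<sigma>, id)))"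
proof (induction w arbitrary: \<sigma> h)
  case (Cons x w)
  obtain \<tau> k where x: "vt_act l x (\<sigma>, id) = (\<tau>, k)" by fastforce
  have "vt_act l x (\<sigma>, h) = (\<tau>, h \<circ> k)"
    using vt_act_snd[of l x \<sigma> h] x by simp
  let ?F = "fold (vt_act l) w (\<tau>, id)"
  have "fold (vt_act l) (x # w) (\<sigma>, h) = (fst ?F, h \<circ> (k \<circ> snd ?F))"
    unfolding fold_simps(2) \<open>vt_act l x (\<sigma>, h) = (\<tau>, h \<circ> k)\<close> Cons[of \<tau> "h \<circ> k"] comp_assoc ..
  moreover have "fold (vt_act l) (x # w) (\<sigma>, id) = (fst ?F, k \<circ> snd ?F)"
    unfolding fold_simps(2) x by (rule Cons)
  ultimately show ?case by (simp only: fst_conv snd_conv)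
qed simp

lemma inj_fold_vt_act:
  assumes "w \<in> lists (vt_gens n \<times> UNIV)" "inj (fst s)"
  shows "inj (fst (fold (vt_act l) w s))"
proof -
  have "eval_word (sym_group n) vt_gen_perm w \<in> carrier (sym_group n)"
    using sym_group_is_group vt_gen_perm_closed assms(1) by (rule eval_word_closed)
  then have "inj (eval_word (sym_group n) vt_gen_perm w)"
    by (metis permutes_inj sym_group_carrier)
  then show ?thesis using assms by (simp add: fold_vt_act_fst inj_compose)
qed

section \<open>Homomorphisms from labellings\<close>

text \<open>The two rules answer the relations \<open>s_i^2 = 1\<close> and the commutation of
  distant \<open>s_i\<close>. The remaining relations hold for all labels, as both sides meet the
  same labels.\<close>

locale twin_labelling =
  fixes l :: "nat \<Rightarrow> nat \<Rightarrow> 'a \<Rightarrow> 'a"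
  assumes label_inverse: "i \<noteq> j \<Longrightarrow> l i j \<circ> l j i = id"
    and label_commute: "distinct [i, j, i', j'] \<Longrightarrow> l i j \<circ> l i' j' = l i' j' \<circ> l i j"
begin

lemma vt_act_relation:
  assumes "(r, s) \<in> vt_relations n" "inj \<sigma>"
  shows "fold (vt_act l) (pos_word r) (\<sigma>, h) = fold (vt_act l) (pos_word s) (\<sigma>, h)"
proof -
  have inv: "l (\<sigma> i) (\<sigma> (Suc i)) \<circ> l (\<sigma> (Suc i)) (\<sigma> i) = id" for i
    using assms(2) by (intro label_inverse) (simp add: inj_eq)
  have far: "l (\<sigma> i) (\<sigma> (Suc i)) \<circ> l (\<sigma> j) (\<sigma> (Suc j)) = l (\<sigma> j) (\<sigma> (Suc j)) \<circ> l (\<sigma> i) (\<sigma> (Suc i))"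
    if "\<bar>int i - int j\<bar> \<ge> 2" for i j
    using assms(2) that by (intro label_commute) (auto simp: inj_eq)
  have tfar: "transpose i (Suc i) j = j" "transpose i (Suc i) (Suc j) = Suc j"
     "transpose j (Suc j) i = i" "transpose j (Suc j) (Suc i) = Suc i"
    if "\<bar>int i - int j\<bar> \<ge> 2" for i j :: nat
    using that by (auto simp: transpose_def)
  show ?thesis
    using assms(1) unfolding vt_relations_def
    by (elim UnE CollectE exE conjE)
      (auto simp: comp_assoc inv far tfar transpose_far transpose_braid)
qed

lemma vt_act_cancel: "inj (fst s) \<Longrightarrow> vt_act l (a, b') (vt_act l (a, b) s) = s"
  using label_inverse by (cases a; cases s) (simp_all add: comp_assoc inj_eq)

lemma vt_act_pres_rel:
  assumes "(v, w) \<in> pres_rel (vt_gens n) (map_prod pos_word pos_word ` vt_relations n)" "inj (fst s)"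
  shows "fold (vt_act l) v s = fold (vt_act l) w s"
  using assms
proof (induction rule: pres_rel.induct)
  case (cancel a u v b)
  have "inj (fst (fold (vt_act l) u s))"
    using inj_fold_vt_act cancel by blast
  then show ?case by (simp add: vt_act_cancel)
next
  case (relation r' s' u v)
  then obtain r t where "(r, t) \<in> vt_relations n" and rs: "r' = pos_word r" "s' = pos_word t" by auto
  moreover have "inj (fst (fold (vt_act l) u s))"
    using inj_fold_vt_act relation by blast
  ultimately have "fold (vt_act l) r' (fold (vt_act l) u s) = fold (vt_act l) s' (fold (vt_act l) u s)"
    using vt_act_relation by (metis prod.collapse)
  then show ?case by simp
qed auto

definition pvt_map :: "vt_gen word set \<Rightarrow> 'a \<Rightarrow> 'a" where
  "pvt_map A = the_elem ((\<lambda>w. snd (fold (vt_act l) w (id, id))) ` A)"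

lemma pvt_map_class:
  assumes "w \<in> lists (vt_gens n \<times> UNIV)"
  shows "pvt_map (vt_class n w) = snd (fold (vt_act l) w (id, id))"
proof -
  have "(\<lambda>w. snd (fold (vt_act l) w (id, id))) ` vt_class n w = {snd (fold (vt_act l) w (id, id))}"
    using vt_act_pres_rel[of w _ n "(id, id)"] pres_rel.refl[OF assms] by fastforce
  then show ?thesis by (simp add: pvt_map_def)
qed

text \<open>A word for an element of the pure group brings the permutation back to
  \<open>id\<close>, so the following word meets the same labels as it would from the start.\<close>

lemma pvt_map_mult:
  assumes "A \<in> carrier (PVT n)" "B \<in> carrier (PVT n)"
  shows "pvt_map (A \<otimes>\<^bsub>PVT n\<^esub> B) = pvt_map A \<circ> pvt_map B"
proof -
  obtain u where u: "u \<in> lists (vt_gens n \<times> UNIV)" "A = vt_class n u"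
    "eval_word (sym_group n) vt_gen_perm u = id" using assms(1) by (rule PVT_carrierE)
  obtain v where v: "v \<in> lists (vt_gens n \<times> UNIV)" "B = vt_class n v" using assms(2) by (rule PVT_carrierE)
  have uv: "u @ v \<in> lists (vt_gens n \<times> UNIV)" using u v by simp
  have "fst (fold (vt_act l) u (id, id)) = id" using fold_vt_act_fst[OF u(1), of l "(id, id)"] u(3) by simp
  then have "fold (vt_act l) u (id, id) = (id, pvt_map A)"
    by (simp add: prod_eq_iff u(2) pvt_map_class[OF u(1)])
  then have "snd (fold (vt_act l) (u @ v) (id, id)) = snd (fold (vt_act l) v (id, pvt_map A))" by simp
  also have "\<dots> = pvt_map A \<circ> pvt_map B"
    by (subst fold_vt_act_snd) (simp add: v(2) pvt_map_class[OF v(1)])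
  finally show ?thesis
    using pvt_map_class[OF uv] by (simp add: PVT_mult u(2) v(2) vt_class_mult[OF u(1) v(1)])
qed

end

lemma snd_fold_vt_act_in_alt:
  assumes "\<And>i j. l i j \<in> carrier (alt_group m)" "snd s \<in> carrier (alt_group m)"
  shows "snd (fold (vt_act l) w s) \<in> carrier (alt_group m)"
  using assms(2)
proof (induction w arbitrary: s)
  case (Cons x w)
  interpret A: group "alt_group m" by (rule alt_group_is_group)
  have "snd (vt_act l x s) \<in> carrier (alt_group m)"
    using Cons.prems assms(1) A.m_closed unfolding alt_group_mult
    by (cases "(l, x, s)" rule: vt_act.cases) auto
  then show ?case using Cons.IH by simp
qed simp

text \<open>Only the index pairs {1, 2} and {1, 3} get nontrivial labels. They share the index 1, so
  the commutation rule imposes nothing on \<open>a\<close> and \<open>b\<close>: the labels factor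
  through a free group of rank 2. Generators of the alternating group may thus be assigned
  freely.\<close>

lemma PVT_epi_alt:
  assumes n: "n \<ge> 3" and m: "odd m" "m \<ge> 3"
  shows "epis (PVT n) (alt_group m) \<noteq> {}"
proof -
  interpret A: group "alt_group m" by (rule alt_group_is_group)
  define a b where "a = cyc3 1 2 (3 :: nat)" and "b = long_cycle m"
  have ab: "a \<in> carrier (alt_group m)" "b \<in> carrier (alt_group m)"
    using m by (auto simp: a_def b_def intro!: cyc3_in_alt long_cycle_in_alt)
  define l :: "nat \<Rightarrow> nat \<Rightarrow> nat \<Rightarrow> nat" where
    "l i j = (if (i, j) = (1, 2) then a else if (i, j) = (2, 1) then inv' a
      else if (i, j) = (1, 3) then b else if (i, j) = (3, 1) then inv' b else id)" for i j
  have bij: "a \<circ> inv' a = id" "inv' a \<circ> a = id" "b \<circ> inv' b = id" "inv' b \<circ> b = id"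
    using ab by (metis alt_group_carrier permutes_inv_o)+
  interpret twin_labelling l
    by unfold_locales (auto simp: l_def bij)
  have l_alt: "l i j \<in> carrier (alt_group m)" for i j
    using ab alt_group_inv_closed A.one_closed by (auto simp: l_def alt_group_one)
  have in_alt: "pvt_map A \<in> carrier (alt_group m)" if A: "A \<in> carrier (PVT n)" for A
  proof -
    obtain w where w: "w \<in> lists (vt_gens n \<times> UNIV)" "A = vt_class n w" using A by (rule PVT_carrierE)
    show ?thesis
      unfolding w(2) pvt_map_class[OF w(1)] using l_alt A.one_closed
      by (intro snd_fold_vt_act_in_alt) (simp_all add: alt_group_one)
  qed
  have hom: "pvt_map \<in> hom (PVT n) (alt_group m)"
    using in_alt pvt_map_mult by (intro homI) (simp_all add: alt_group_mult)
  interpret h: group_hom "PVT n" "alt_group m" pvt_map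
    using hom group_PVT A.group_axioms by (simp add: group_hom_def group_hom_axioms_def)
  have val: "pvt_map (vt_class n (pos_word w)) \<in> pvt_map ` carrier (PVT n)"
    if "w \<in> lists (vt_gens n)" "fst (fold (vt_act l) (pos_word w) (id, id)) = id" for w
  proof -
    have w: "pos_word w \<in> lists (vt_gens n \<times> UNIV)" using that(1) by auto
    have "eval_word (sym_group n) vt_gen_perm (pos_word w) = id"
      using that(2) fold_vt_act_fst[OF w, of l "(id, id)"] by simp
    then show ?thesis using PVT_carrierI[OF w] by blast
  qed
  have gens: "S 1 \<in> vt_gens n" "Rho 1 \<in> vt_gens n" "Rho 2 \<in> vt_gens n" using n by (auto simp: vt_gens_def)
  have "pvt_map (vt_class n (pos_word [S 1, Rho 1])) = a"
    using gens by (subst pvt_map_class) (auto simp: l_def)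
  \<comment> \<open>After \<open>Rho 2\<close> the permutation is (2 3), so \<open>S 1\<close> is
    read with label \<open>l 1 3\<close>.\<close>
  moreover have "pvt_map (vt_class n (pos_word [Rho 2, S 1, Rho 1, Rho 2])) = b"
    using gens by (subst pvt_map_class) (auto simp: l_def transpose_def)
  moreover have "transpose 2 3 \<circ> transpose 1 2 \<circ> transpose 1 2 \<circ> transpose 2 (3 :: nat) = id"
    by (simp add: comp_assoc)
  ultimately have img: "a \<in> pvt_map ` carrier (PVT n)" "b \<in> pvt_map ` carrier (PVT n)"
    using val[of "[S 1, Rho 1]"] val[of "[Rho 2, S 1, Rho 1, Rho 2]"] gens
    by (simp_all add: comp_assoc numeral_2_eq_2 numeral_3_eq_3)
  have "pvt_map ` carrier (PVT n) = carrier (alt_group m)"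
    using alt_group_generated[OF m(1) h.img_is_subgroup] img by (simp add: a_def b_def)
  then have "pvt_map \<in> epis (PVT n) (alt_group m)"
    unfolding epis_def using hom by blast
  then show ?thesis by blast
qed

section \<open>The case of two strands\<close>

text \<open>The involution \<open>r\<close> inverts \<open>t = s r\<close>, so the set
  \<open>D\<close> of normal forms is closed under left multiplication by \<open>r\<close> and
  \<open>s\<close>.\<close>

lemma (in group) dihedral_elements:
  assumes sr: "s \<in> carrier G" "r \<in> carrier G" "s \<otimes> s = \<one>" "r \<otimes> r = \<one>"
    and x: "x \<in> generate G {s, r}"
  shows "\<exists>k :: int. x = (s \<otimes> r) [^] k \<or> x = (s \<otimes> r) [^] k \<otimes> r"
proof -
  define t where "t = s \<otimes> r"
  have t: "t \<in> carrier G" using sr by (simp add: t_def)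
  have inv: "inv s = s" "inv r = r" using sr by (auto intro: inv_equality)
  have tr: "t \<otimes> r = s" using sr by (simp add: t_def m_assoc)
  have it: "inv t = r \<otimes> s" using sr by (simp add: t_def inv_mult_group inv)
  have conj: "r \<otimes> t [^] k = t [^] (- k) \<otimes> r" for k :: int
  proof -
    have nat: "r \<otimes> t [^] k = inv t [^] k \<otimes> r" for k :: nat
    proof (induction k)
      case (Suc k)
      have "r \<otimes> t [^] Suc k = r \<otimes> t [^] k \<otimes> t" using sr t by (simp add: m_assoc)
      also have "\<dots> = inv t [^] k \<otimes> (r \<otimes> t)" using sr t by (simp add: Suc m_assoc)
      also have "r \<otimes> t = inv t \<otimes> r"
        unfolding it using sr by (simp add: t_def m_assoc)
      finally show ?case using sr t by (simp add: m_assoc)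
    qed (use sr in simp)
    show ?thesis
    proof (cases k rule: int_cases2)
      case (nonneg j)
      then show ?thesis using nat[of j] t by (simp add: int_pow_neg_int nat_pow_inv int_pow_int)
    next
      case (nonpos j)
      have "r \<otimes> inv t [^] j = r \<otimes> (inv t [^] j \<otimes> r) \<otimes> r" using sr t by (simp add: m_assoc)
      also have "\<dots> = r \<otimes> (r \<otimes> t [^] j) \<otimes> r" by (simp add: nat)
      also have "\<dots> = t [^] j \<otimes> r" using sr t by (simp flip: m_assoc)
      finally show ?thesis using nonpos t by (simp add: int_pow_neg_int nat_pow_inv int_pow_int)
    qed
  qed
  define D where "D = {t [^] k | k :: int. True} \<union> {t [^] k \<otimes> r | k :: int. True}"
  have rD: "r \<otimes> d \<in> D" if "d \<in> D" for d
    using that sr t unfolding D_def by (auto simp: conj m_assoc[symmetric])  (auto simp: m_assoc)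
  have tD: "t \<otimes> d \<in> D" if "d \<in> D" for d
  proof -
    have "t \<otimes> t [^] k = t [^] (1 + k)" for k :: int using t by (simp add: int_pow_mult)
    then show ?thesis using that sr t unfolding D_def by (auto simp flip: m_assoc)
  qed
  have D_car: "D \<subseteq> carrier G" using sr t by (auto simp: D_def)
  have sD: "s \<otimes> d \<in> D" if "d \<in> D" for d
    using tD[OF rD[OF that]] D_car that sr t unfolding tr[symmetric] by (auto simp: m_assoc subset_iff)
  have mult: "y \<otimes> d \<in> D" if "y \<in> generate G {s, r}" "d \<in> D" for y d
    using that
  proof (induction arbitrary: d rule: generate.induct)
    case (eng y z)
    have "y \<in> carrier G" "z \<in> carrier G" using eng.hyps sr generate_incl[of "{s, r}"] by auto
    then show ?case using eng D_car by (simp add: m_assoc subset_iff)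
  qed (use D_car sD rD inv in auto)
  have "\<one> \<in> D" unfolding D_def by (auto intro!: exI[of _ "0 :: int"])
  then have "x \<in> D" using mult[OF x] generate_incl[of "{s, r}"] x sr by fastforce
  then show ?thesis by (auto simp: D_def t_def)
qed

text \<open>For inversion, the twisted conjugate of \<open>y\<close> by \<open>g\<close> is
  \<open>g y g\<close>. This changes the exponent of \<open>t\<close> by an even number, so every
  class contains 1 or \<open>t\<close>.\<close>

lemma not_R_infinity_cyclic:
  assumes "group G" "t \<in> carrier G" "\<And>x. x \<in> carrier G \<Longrightarrow> \<exists>k :: int. x = t [^]\<^bsub>G\<^esub> k"
  shows "\<not> R_infinity G"
proof -
  interpret group G by fact
  have comm: "x \<otimes>\<^bsub>G\<^esub> y = y \<otimes>\<^bsub>G\<^esub> x" if "x \<in> carrier G" "y \<in> carrier G" for x y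
    using assms(3)[OF that(1)] assms(3)[OF that(2)] assms(2) by (auto simp: add.commute simp flip: int_pow_mult)
  define \<phi> where "\<phi> = (\<lambda>x\<in>carrier G. inv\<^bsub>G\<^esub> x)"
  have hom: "\<phi> \<in> hom G G"
    by (rule homI) (auto simp: \<phi>_def inv_mult_group intro: comm)
  moreover have "\<phi> \<in> Bij (carrier G)"
    unfolding Bij_def by (auto simp: \<phi>_def intro!: bij_betw_byWitness[where f' = "m_inv G"])
  ultimately have \<phi>: "\<phi> \<in> auto G" by (simp add: auto_def)
  note eq = equiv_twisted_conj[OF assms(1) hom]
  have "C \<in> {twisted_conj G \<phi> `` {\<one>\<^bsub>G\<^esub>}, twisted_conj G \<phi> `` {t}}"
    if C: "C \<in> carrier G // twisted_conj G \<phi>" for C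
  proof -
    obtain x where x: "x \<in> carrier G" "C = twisted_conj G \<phi> `` {x}" using C by (rule quotientE)
    obtain k :: int where k: "x = t [^]\<^bsub>G\<^esub> k" using assms(3)[OF x(1)] by blast
    define j where "j = k div 2"
    have tj: "t [^]\<^bsub>G\<^esub> j \<in> carrier G" using assms(2) by simp
    have "(x, if even k then \<one>\<^bsub>G\<^esub> else t) \<in> twisted_conj G \<phi>"
    proof -
      have "x = t [^]\<^bsub>G\<^esub> j \<otimes>\<^bsub>G\<^esub> (if even k then \<one>\<^bsub>G\<^esub> else t) \<otimes>\<^bsub>G\<^esub> inv\<^bsub>G\<^esub> \<phi> (t [^]\<^bsub>G\<^esub> j)"
      proof (cases "even k")
        case True
        then have "k = j + j" by (auto simp: j_def)
        then show ?thesis using True tj assms(2) int_pow_mult[OF assms(2), of j j] by (simp add: k \<phi>_def)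
      next
        case False
        then have "k = j + 1 + j" unfolding j_def by presburger
        then have "x = t [^]\<^bsub>G\<^esub> j \<otimes>\<^bsub>G\<^esub> t \<otimes>\<^bsub>G\<^esub> t [^]\<^bsub>G\<^esub> j"
          by (simp only: k int_pow_mult[OF assms(2)] int_pow_1[OF assms(2)])
        then show ?thesis using False tj assms(2) by (simp add: \<phi>_def)
      qed
      then show ?thesis using x(1) tj assms(2) unfolding twisted_conj_def by auto
    qed
    then show ?thesis using equiv_class_eq[OF eq] x(2) by (cases "even k") auto
  qed
  then have "carrier G // twisted_conj G \<phi> \<subseteq> {twisted_conj G \<phi> `` {\<one>\<^bsub>G\<^esub>}, twisted_conj G \<phi> `` {t}}"
    by (rule subsetI)
  then have "finite (carrier G // twisted_conj G \<phi>)"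
    by (rule finite_subset) simp
  then show ?thesis using \<phi> unfolding R_infinity_def by blast
qed

text \<open>The two involutions generate, so every element is \<open>t^k\<close> or
  \<open>t^k r\<close> with \<open>t = s r\<close>. The second form maps to the transposition, which
  leaves the powers of \<open>t\<close> as kernel.\<close>

lemma PVT_2_not_R_infinity: "\<not> R_infinity (PVT 2)"
proof -
  interpret h: group_hom "VT 2" "sym_group 2" "vt_proj 2" by (rule vt_proj_group_hom)
  define s r where "s = vt_class 2 [(S 1, True)]" and "r = vt_class 2 [(Rho 1, True)]"
  have gens: "vt_gens 2 = {S 1, Rho 1}" by (auto simp: vt_gens_def)
  have sr: "s \<in> carrier (VT 2)" "r \<in> carrier (VT 2)"
    unfolding s_def r_def VT_def by (auto intro!: presented_group_carrierI simp: gens)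
  have "([(S 1, True), (S 1, True)], []) \<in> map_prod pos_word pos_word ` vt_relations 2"
    "([(Rho 1, True), (Rho 1, True)], []) \<in> map_prod pos_word pos_word ` vt_relations 2"
    by (force simp: vt_relations_def image_iff)+
  from this[THEN pres_rel.relation[of _ _ _ "vt_gens 2" "[]" "[]"]]
  have "vt_class 2 [(S 1, True), (S 1, True)] = vt_class 2 []" "vt_class 2 [(Rho 1, True), (Rho 1, True)] = vt_class 2 []"
    by (auto simp: gens intro!: equiv_class_eq[OF equiv_pres_rel])
  then have inv: "s \<otimes>\<^bsub>VT 2\<^esub> s = \<one>\<^bsub>VT 2\<^esub>" "r \<otimes>\<^bsub>VT 2\<^esub> r = \<one>\<^bsub>VT 2\<^esub>"
    using vt_class_mult[of "[(S 1, True)]" 2 "[(S 1, True)]"] vt_class_mult[of "[(Rho 1, True)]" 2 "[(Rho 1, True)]"]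
    by (simp_all add: s_def r_def gens VT_def presented_group_def)
  have "vt_gen_perm (S 1) = transpose 1 2" "vt_gen_perm (Rho 1) = transpose 1 2"
    by (simp_all add: numeral_2_eq_2)
  then have proj: "vt_proj 2 s = transpose 1 2" "vt_proj 2 r = transpose 1 2"
    using vt_proj_generator[of "S 1" 2] vt_proj_generator[of "Rho 1" 2] unfolding s_def r_def
    by (simp_all only: gens insert_iff simp_thms)
  define t where "t = s \<otimes>\<^bsub>VT 2\<^esub> r"
  have t: "t \<in> carrier (VT 2)" "vt_proj 2 t = \<one>\<^bsub>sym_group 2\<^esub>"
    using sr proj by (simp_all add: t_def sym_group_mult sym_group_one)
  have tP: "t \<in> carrier (PVT 2)" using t by (simp add: PVT_def kernel_def)
  have "\<exists>k :: int. x = t [^]\<^bsub>PVT 2\<^esub> k" if x: "x \<in> carrier (PVT 2)" for x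
  proof -
    have xV: "x \<in> carrier (VT 2)" "vt_proj 2 x = \<one>\<^bsub>sym_group 2\<^esub>" using x by (auto simp: PVT_def kernel_def)
    have "carrier (VT 2) = generate (VT 2) {s, r}"
      using presented_group_generate[of "vt_gens 2"] by (simp add: VT_def s_def r_def gens)
    then obtain k :: int where k: "x = t [^]\<^bsub>VT 2\<^esub> k \<or> x = t [^]\<^bsub>VT 2\<^esub> k \<otimes>\<^bsub>VT 2\<^esub> r"
      using h.G.dihedral_elements[OF sr inv, of x] xV unfolding t_def by blast
    have tk: "vt_proj 2 (t [^]\<^bsub>VT 2\<^esub> k) = \<one>\<^bsub>sym_group 2\<^esub>"
      using h.hom_int_pow[OF t(1)] t(2) by simp
    have "x \<noteq> t [^]\<^bsub>VT 2\<^esub> k \<otimes>\<^bsub>VT 2\<^esub> r"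
    proof
      assume "x = t [^]\<^bsub>VT 2\<^esub> k \<otimes>\<^bsub>VT 2\<^esub> r"
      then have "transpose 1 2 = (id :: nat \<Rightarrow> nat)"
        using xV tk t(1) sr proj by (simp add: sym_group_one sym_group_mult)
      then have "transpose 1 2 (1 :: nat) = 1" by simp
      then show False by simp
    qed
    moreover have "t [^]\<^bsub>VT 2\<^esub> k = t [^]\<^bsub>PVT 2\<^esub> k"
      using h.G.int_pow_consistent[OF h.subgroup_kernel, of t k] tP by (simp add: PVT_def)
    ultimately show ?thesis using k by auto
  qed
  then show ?thesis using not_R_infinity_cyclic[OF group_PVT tP] by blast
qed

theorem theorem5p8:
  fixes n :: nat
  assumes "n \<ge> 2"
  shows "R_infinity (PVT n) \<longleftrightarrow> n \<ge> 3"
proof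
  assume "R_infinity (PVT n)"
  then have "n \<noteq> 2" using PVT_2_not_R_infinity by blast
  then show "n \<ge> 3" using assms by simp
next
  assume n: "n \<ge> 3"
  obtain Y where Y: "finite Y" "Y \<subseteq> carrier (PVT n)" "generate (PVT n) Y = carrier (PVT n)"
    by (rule PVT_finitely_generated)
  show "R_infinity (PVT n)"
  proof (rule R_infinity_of_simple_quotients[OF group_PVT Y])
    fix B :: nat
    \<comment> \<open>Beyond 7 the prime is odd, so the degree \<open>p + 2\<close> is odd too and
      the long cycle of that length is even.\<close>
    obtain p where p: "prime p" "p > max B 7" using bigger_prime by blast
    then have "odd (p + 2)" using prime_odd_nat[of p] by simp
    then have "prime_fused p (alt_group (p + 2))" "epis (PVT n) (alt_group (p + 2)) \<noteq> {}"
      using alt_group_prime_fused[of p] PVT_epi_alt[OF n, of "p + 2"] p by simp_all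
    then show "\<exists>p (T :: (nat \<Rightarrow> nat) monoid). B < p \<and> prime_fused p T \<and> epis (PVT n) T \<noteq> {}"
      using p(2) by (intro exI[of _ p] exI[of _ "alt_group (p + 2)"]) simp
  qed
qed

end
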